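(* Let $P,Q_1,Q_2$ be general points in $\mathbb{P}^3$. Then there exists a unique surface of degree $6$ vanishing at all points of $Z_{60}$ with a point of multiplicity $4$ at $P$ and points of multiplicity $2$ at both $Q_1$ and $Q_2$.
   Context: We work over $\mathbb{C}$. The Klein configuration $Z_{60}\subset\mathbb{P}^3=\mathbb{P}^3_{\mathbb{C}}$ (homogeneous coordinates $[x:y:z:w]$) is the following set of $60$ points: the $4$ coordinate points $[1:0:0:0],[0:1:0:0],[0:0:1:0],[0:0:0:1]$; the $24$ points having exactly two nonzero coordinates, the first nonzero coordinate being $1$ and the other one lying in $\{1,i,-1,-i\}$; and the $32$ points $[1:\pm1:\pm1:\pm1]$, $[1:\pm1:\pm i:\pm i]$, $[1:\pm i:\pm1:\pm i]$, $[1:\pm i:\pm i:\pm1]$ (all signs chosen independently). "General" means: $(P,Q_1,Q_2)$ lies in some nonempty Zariski open subset of $\mathbb{P}^3\times\mathbb{P}^3\times\mathbb{P}^3$. *)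

theory Defs
  imports "HOL-Analysis.Analysis" "HOL-Library.Poly_Mapping"
begin

text \<open>A polynomial in variables indexed by \<open>'v\<close> is a finitely supported map from exponents to
  coefficients; \<open>(+)\<close> and \<open>(*)\<close> of \<^theory>\<open>HOL-Library.Poly_Mapping\<close> are then the polynomial
  operations.\<close>

type_synonym 'v cpoly = "('v \<Rightarrow>\<^sub>0 nat) \<Rightarrow>\<^sub>0 complex"

definition const_poly :: "complex \<Rightarrow> 'v cpoly" where
  "const_poly c = Poly_Mapping.single 0 c"

definition eval_poly :: "'v cpoly \<Rightarrow> ('v \<Rightarrow> complex) \<Rightarrow> complex" where
  "eval_poly f x =
     (\<Sum>m\<in>Poly_Mapping.keys f. Poly_Mapping.lookup f m *
        (\<Prod>v\<in>Poly_Mapping.keys m. x v ^ Poly_Mapping.lookup m v))"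

text \<open>When \<open>v\<close> does not occur in \<open>m\<close>, the truncated exponent is harmless since the coefficient
  is \<open>0\<close>.\<close>

definition partial_deriv :: "'v \<Rightarrow> 'v cpoly \<Rightarrow> 'v cpoly" where
  "partial_deriv v f =
     (\<Sum>m\<in>Poly_Mapping.keys f.
        Poly_Mapping.single (m - Poly_Mapping.single v 1)
          (of_nat (Poly_Mapping.lookup m v) * Poly_Mapping.lookup f m))"

definition homogeneous :: "nat \<Rightarrow> ('v::finite) cpoly \<Rightarrow> bool" where
  "homogeneous d f \<longleftrightarrow>
     (\<forall>m\<in>Poly_Mapping.keys f. (\<Sum>v\<in>UNIV. Poly_Mapping.lookup m v) = d)"

definition proportional :: "complex ^ 4 \<Rightarrow> complex ^ 4 \<Rightarrow> bool" where
  "proportional v w \<longleftrightarrow> v \<noteq> 0 \<and> w \<noteq> 0 \<and> (\<exists>c. c \<noteq> 0 \<and> w = c *s v)"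

lemma part_equivp_proportional: "part_equivp proportional"
proof (rule part_equivpI)
  show "\<exists>v. proportional v v"
    by (rule exI[of _ "axis 1 1"])
      (auto simp: proportional_def axis_eq_0_iff intro!: exI[of _ 1])
  show "symp proportional"
  proof (rule sympI)
    fix v w assume "proportional v w"
    then obtain c where c: "v \<noteq> 0" "w \<noteq> 0" "c \<noteq> 0" "w = c *s v"
      by (auto simp: proportional_def)
    then have "v = inverse c *s w"
      by (simp add: vector_smult_assoc)
    with c show "proportional w v"
      unfolding proportional_def by (metis inverse_nonzero_iff_nonzero)
  qed
  show "transp proportional"
  proof (rule transpI)
    fix u v w assume "proportional u v" "proportional v w"
    then obtain c d where "u \<noteq> 0" "w \<noteq> 0" "c \<noteq> 0" "d \<noteq> 0" "w = (d * c) *s u"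
      by (auto simp: proportional_def vector_smult_assoc)
    then show "proportional u w"
      unfolding proportional_def by (metis mult_eq_0_iff)
  qed
qed

text \<open>\<open>abs_P3 v\<close> is the point with homogeneous coordinate vector \<open>v \<noteq> 0\<close>; \<open>rep_P3 P\<close> is some
  homogeneous coordinate vector of \<open>P\<close>. Below, \<open>rep_P3\<close> is only used in conditions that do not
  depend on that choice, because the polynomials involved are (multi)homogeneous.\<close>

quotient_type P3 = "complex ^ 4" / partial: proportional
  by (rule part_equivp_proportional)

definition pt :: "complex \<Rightarrow> complex \<Rightarrow> complex \<Rightarrow> complex \<Rightarrow> P3" where
  "pt x y z w = abs_P3 (vector [x, y, z, w])"

text \<open>The variables \<open>Inl i\<close>, \<open>Inr (Inl i)\<close>, \<open>Inr (Inr i)\<close> are the homogeneous coordinates on the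
  first, second and third factor.\<close>

definition trihomogeneous :: "nat \<Rightarrow> nat \<Rightarrow> nat \<Rightarrow> (4 + 4 + 4) cpoly \<Rightarrow> bool" where
  "trihomogeneous a b c f \<longleftrightarrow>
     (\<forall>m\<in>Poly_Mapping.keys f.
        (\<Sum>i\<in>UNIV. Poly_Mapping.lookup m (Inl i)) = a \<and>
        (\<Sum>i\<in>UNIV. Poly_Mapping.lookup m (Inr (Inl i))) = b \<and>
        (\<Sum>i\<in>UNIV. Poly_Mapping.lookup m (Inr (Inr i))) = c)"

definition tri_coords :: "P3 \<times> P3 \<times> P3 \<Rightarrow> 4 + 4 + 4 \<Rightarrow> complex" where
  "tri_coords = (\<lambda>(P, Q, R). case_sum (($) (rep_P3 P)) (case_sum (($) (rep_P3 Q)) (($) (rep_P3 R))))"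

definition zariski_closed :: "(P3 \<times> P3 \<times> P3) set \<Rightarrow> bool" where
  "zariski_closed V \<longleftrightarrow>
     (\<exists>T. (\<forall>f\<in>T. \<exists>a b c. trihomogeneous a b c f) \<and>
          V = {t. \<forall>f\<in>T. eval_poly f (tri_coords t) = 0})"

definition zariski_open :: "(P3 \<times> P3 \<times> P3) set \<Rightarrow> bool" where
  "zariski_open U \<longleftrightarrow> zariski_closed (- U)"

text \<open>A surface of degree \<open>d\<close> (as an effective divisor) is a nonzero form of degree \<open>d\<close> up to
  nonzero scalars, represented by the set of its equations.\<close>

definition surface :: "nat \<Rightarrow> 4 cpoly set \<Rightarrow> bool" where
  "surface d S \<longleftrightarrow>
     (\<exists>F. F \<noteq> 0 \<and> homogeneous d F \<and> S = {const_poly c * F | c. c \<noteq> 0})"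

definition vanishes_at :: "4 cpoly set \<Rightarrow> P3 \<Rightarrow> bool" where
  "vanishes_at S P \<longleftrightarrow> (\<forall>F\<in>S. eval_poly F (($) (rep_P3 P)) = 0)"

text \<open>The order of vanishing of \<open>F\<close> at \<open>p\<close>: the least order of a partial derivative that does not
  vanish at \<open>p\<close>, where the list \<open>is\<close> gives the variables to differentiate by. For a nonzero form
  \<open>F\<close> and \<open>p \<noteq> 0\<close> this is, by Euler's relation, also the order of vanishing of a local affine
  equation of the surface \<open>F = 0\<close> at the point \<open>[p]\<close>.\<close>

definition order_at :: "'v cpoly \<Rightarrow> ('v \<Rightarrow> complex) \<Rightarrow> nat" where
  "order_at F p = (LEAST k. \<exists>is. length is = k \<and> eval_poly (foldr partial_deriv is F) p \<noteq> 0)"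

definition has_multiplicity :: "4 cpoly set \<Rightarrow> P3 \<Rightarrow> nat \<Rightarrow> bool" where
  "has_multiplicity S P k \<longleftrightarrow> (\<forall>F\<in>S. order_at F (($) (rep_P3 P)) = k)"

definition Z60 :: "P3 set" where
  "Z60 =
     {pt 1 0 0 0, pt 0 1 0 0, pt 0 0 1 0, pt 0 0 0 1} \<union>
     (\<Union>u\<in>{1, \<i>, - 1, - \<i>}.
        {pt 1 u 0 0, pt 1 0 u 0, pt 1 0 0 u, pt 0 1 u 0, pt 0 1 0 u, pt 0 0 1 u}) \<union>
     (\<Union>a\<in>{1, - 1}. \<Union>b\<in>{1, - 1}. \<Union>c\<in>{1, - 1}.
        {pt 1 a b c, pt 1 a (b * \<i>) (c * \<i>), pt 1 (a * \<i>) b (c * \<i>), pt 1 (a * \<i>) (b * \<i>) c})"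

end

theory Submission
  imports Defs
begin

text \<open>Write \<open>p\<^bsub>ij\<^esub>\<close> for the Plucker coordinates of the line joining two points and let
  \<open>\<omega>\<close> run through the six forms \<open>p\<^bsub>12\<^esub> \<plusminus> p\<^bsub>34\<^esub>\<close>, \<open>p\<^bsub>13\<^esub> \<plusminus> p\<^bsub>24\<^esub>\<close>,
  \<open>p\<^bsub>14\<^esub> \<plusminus> p\<^bsub>23\<^esub>\<close>. For any points \<open>A\<close>, \<open>B\<close>, a suitably signed sum of the sextics
  \<open>\<omega>(P, X)\<^sup>4 \<omega>(A, X) \<omega>(B, X)\<close> in \<open>X\<close> passes through the Klein configuration and has multiplicity at
  least 4 at \<open>P\<close>. For general \<open>P\<close> these sextics span a space of dimension 9 (rather than 4, as a
  count of conditions suggests), and two double points impose only 8 conditions, so a sextic exists.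
  Uniqueness, and the fact that the multiplicities are not larger, say that certain linear systems
  have trivial kernel. This is an open condition, so it suffices to check it at one triple of
  points.\<close>

subsection \<open>Evaluation and derivatives of polynomials\<close>

text \<open>Sextics through the configuration form a space of dimension 84 - 60 = 24, and a
  quadruple point should cost 20 more, whence the expected 4. The nine come from bilinearity: for
  fixed P the signed sum is symmetric and bilinear in A and B, so pairs of coordinate points
  generate all of these sextics. The obstacle for the openness argument is that the conditions on
  the sextic have a one-dimensional kernel, not a trivial one. Adding one equation, the vanishing of
  a single derivative whose order is the prescribed multiplicity at one of the points, makes the
  kernel trivial exactly when there is at most one sextic up to scalars and this derivative does not
  vanish on it. Three such extended systems, one for each point, settle uniqueness and all three
  exact multiplicities.\<close>

abbreviation (input) lk where "lk \<equiv> Poly_Mapping.lookup"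
abbreviation (input) sg where "sg \<equiv> Poly_Mapping.single"

text \<open>The product runs over all variables, not only the support as in
  \<open>eval_poly\<close>, so that multiplicativity in the exponent needs no comparison of
  supports.\<close>

definition mon_eval :: "('v::finite \<Rightarrow>\<^sub>0 nat) \<Rightarrow> ('v \<Rightarrow> complex) \<Rightarrow> complex" where
  "mon_eval m x = (\<Prod>v\<in>UNIV. x v ^ lk m v)"

lemma mon_eval_add: "mon_eval (m + n) x = mon_eval m x * mon_eval n x"
  by (simp add: mon_eval_def lookup_add power_add prod.distrib)

lemma mon_eval_zero [simp]: "mon_eval 0 x = 1"
  by (simp add: mon_eval_def)

lemma mon_eval_single: "mon_eval (sg v k) x = x v ^ k"
proof -
  have "mon_eval (sg v k) x = (\<Prod>u\<in>UNIV. if u = v then x v ^ k else 1)"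
    unfolding mon_eval_def by (intro prod.cong) (auto simp: lookup_single_not_eq)
  then show ?thesis by simp
qed

lemma eval_poly_mon: "eval_poly f x = (\<Sum>m\<in>Poly_Mapping.keys f. lk f m * mon_eval m x)"
  unfolding eval_poly_def mon_eval_def
  by (intro sum.cong refl arg_cong2[where f = "(*)"] prod.mono_neutral_left)
    (auto simp: in_keys_iff)

lemma eval_poly_superset:
  assumes "finite S" "Poly_Mapping.keys f \<subseteq> S"
  shows "eval_poly f x = (\<Sum>m\<in>S. lk f m * mon_eval m x)"
  unfolding eval_poly_mon
  by (rule sum.mono_neutral_left) (use assms in \<open>auto simp: in_keys_iff\<close>)

lemma eval_poly_zero [simp]: "eval_poly 0 x = 0"
  by (simp add: eval_poly_def)

lemma eval_poly_single [simp]: "eval_poly (sg m c) x = c * mon_eval m x"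
  by (simp add: eval_poly_mon)

lemma eval_poly_add [simp]:
  fixes f g :: "'v::finite cpoly"
  shows "eval_poly (f + g) x = eval_poly f x + eval_poly g x"
proof -
  let ?S = "Poly_Mapping.keys f \<union> Poly_Mapping.keys g"
  have "eval_poly (f + g) x = (\<Sum>m\<in>?S. lk (f + g) m * mon_eval m x)"
    using keys_add[of f g] by (intro eval_poly_superset) auto
  also have "\<dots> = (\<Sum>m\<in>?S. lk f m * mon_eval m x) + (\<Sum>m\<in>?S. lk g m * mon_eval m x)"
    by (simp add: lookup_add distrib_right sum.distrib)
  also have "\<dots> = eval_poly f x + eval_poly g x"
    using eval_poly_superset[of ?S f x] eval_poly_superset[of ?S g x] by simp
  finally show ?thesis .
qed

lemma eval_poly_sum: "eval_poly (sum f A) x = (\<Sum>a\<in>A. eval_poly (f a :: 'v::finite cpoly) x)"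
  by (induction A rule: infinite_finite_induct) auto

lemma poly_as_sum: "f = (\<Sum>m\<in>Poly_Mapping.keys f. sg m (lk f m))"
  by (rule poly_mapping_eqI)
    (auto simp: lookup_sum lookup_single when_def in_keys_iff)

text \<open>Reduces additive identities to monomials; used once in each factor, it reduces product
  formulas to pairs of monomials.\<close>

lemma poly_induct [case_names single add]:
  fixes f :: "'v cpoly"
  assumes "\<And>m c. P (sg m c)" "\<And>f g. P f \<Longrightarrow> P g \<Longrightarrow> P (f + g)"
  shows "P f"
proof -
  have "P (\<Sum>m\<in>A. sg m (lk f m))" if "finite A" for A
    using that
  proof induction
    case empty
    show ?case using assms(1)[of 0 0] by simp
  qed (auto intro: assms)
  then show ?thesis by (metis finite_keys poly_as_sum)
qed

lemma eval_poly_mult [simp]: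
  fixes f g :: "'v::finite cpoly"
  shows "eval_poly (f * g) x = eval_poly f x * eval_poly g x"
proof (induction f rule: poly_induct)
  case (single m c)
  show ?case
    by (induction g rule: poly_induct) (auto simp: mult_single mon_eval_add distrib_left)
qed (auto simp: distrib_right)

lemma eval_poly_const [simp]: "eval_poly (const_poly c) (x :: 'v::finite \<Rightarrow> _) = c"
  by (simp add: const_poly_def)

lemma eval_poly_power [simp]: "eval_poly (f ^ n) x = eval_poly (f :: 'v::finite cpoly) x ^ n"
proof (induction n)
  case 0
  show ?case using eval_poly_single[of 0 1 x] by simp
qed auto

lemma const_poly_mult: "const_poly a * (const_poly b * f) = const_poly (a * b) * (f :: 'v cpoly)"
  by (simp add: const_poly_def mult_single flip: mult.assoc)

lemma lookup_const_poly_mult: "lk (const_poly c * f) m = c * lk (f :: 'v cpoly) m"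
proof (induction f rule: poly_induct)
  case (single n d)
  then show ?case by (simp add: const_poly_def mult_single lookup_single when_def)
qed (auto simp: lookup_add distrib_left)

text \<open>Only the exponent \<open>m + sg v 1\<close> contributes to the coefficient at
  \<open>m\<close>. This form gives linearity at once and lets explicit coefficients of derivatives
  be read off later.\<close>

lemma lookup_partial_deriv:
  "lk (partial_deriv v f) m = of_nat (lk m v + 1) * lk f (m + sg v 1)"
proof -
  have *: "lk (sg (n - sg v 1) (of_nat (lk n v) * lk f n)) m
      = (if n = m + sg v 1 then of_nat (lk m v + 1) * lk f (m + sg v 1) else 0)" for n
  proof (cases "n = m + sg v 1")
    case True
    then show ?thesis by (simp add: lookup_add)
  next
    case False
    have "n = m + sg v 1" if "lk n v \<noteq> 0" "n - sg v 1 = m"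
    proof (rule poly_mapping_eqI)
      fix u
      show "lk n u = lk (m + sg v 1) u"
        using that by (auto simp: lookup_add lookup_minus lookup_single when_def)
    qed
    with False show ?thesis by (auto simp: lookup_single when_def)
  qed
  show ?thesis
    unfolding partial_deriv_def lookup_sum * by (simp add: in_keys_iff)
qed

lemma partial_deriv_add [simp]: "partial_deriv v (f + g) = partial_deriv v f + partial_deriv v g"
  by (rule poly_mapping_eqI) (simp add: lookup_partial_deriv lookup_add distrib_left)

lemma partial_deriv_zero [simp]: "partial_deriv v 0 = 0"
  by (rule poly_mapping_eqI) (simp add: lookup_partial_deriv)

lemma partial_deriv_const_mult [simp]:
  "partial_deriv v (const_poly c * f) = const_poly c * partial_deriv v f"
  by (rule poly_mapping_eqI) (simp add: lookup_partial_deriv lookup_const_poly_mult)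

lemma partial_deriv_single:
  "partial_deriv v (sg m c) = sg (m - sg v 1) (of_nat (lk m v) * c)"
  by (simp add: partial_deriv_def)

lemma partial_deriv_mult:
  "partial_deriv v (f * g) = partial_deriv v f * g + f * partial_deriv v (g :: 'v cpoly)"
proof (induction f rule: poly_induct)
  case (single m c)
  show ?case
  proof (induction g rule: poly_induct)
    case (single n d)
    \<comment> \<open>Truncated subtraction commutes with adding the other exponent only if
      \<open>v\<close> occurs; if it does not, the coefficient is zero and the exponent is
      irrelevant.\<close>
    have 1: "m + n - sg v 1 = m - sg v 1 + n" if "lk m v \<noteq> 0"
      by (rule poly_mapping_eqI) (use that in \<open>auto simp: lookup_add lookup_minus lookup_single when_def\<close>)
    have 2: "m + n - sg v 1 = m + (n - sg v 1)" if "lk n v \<noteq> 0"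
      by (rule poly_mapping_eqI) (use that in \<open>auto simp: lookup_add lookup_minus lookup_single when_def\<close>)
    have "sg (m + n - sg v 1) (of_nat (lk m v) * c * d) = sg (m - sg v 1 + n) (of_nat (lk m v) * c * d)"
      using 1 by (cases "lk m v = 0") auto
    moreover have "sg (m + n - sg v 1) (of_nat (lk n v) * c * d) = sg (m + (n - sg v 1)) (of_nat (lk n v) * c * d)"
      using 2 by (cases "lk n v = 0") auto
    moreover have "of_nat (lk (m + n) v) * (c * d) = of_nat (lk m v) * c * d + of_nat (lk n v) * c * d"
      by (simp add: lookup_add algebra_simps)
    ultimately show ?case
      by (simp add: mult_single partial_deriv_single single_add ac_simps)
  qed (auto simp: distrib_left)
qed (auto simp: distrib_right)

section \<open>Iterated derivatives and order of vanishing\<close>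

abbreviation deriv_list :: "'v list \<Rightarrow> 'v cpoly \<Rightarrow> 'v cpoly" where
  "deriv_list is f \<equiv> foldr partial_deriv is f"

lemma deriv_list_add [simp]: "deriv_list is (f + g) = deriv_list is f + deriv_list is g"
  by (induction "is") auto

lemma deriv_list_zero [simp]: "deriv_list is 0 = 0"
  by (induction "is") auto

lemma deriv_list_sum: "deriv_list is (sum f A) = (\<Sum>a\<in>A. deriv_list is (f a))"
  by (induction A rule: infinite_finite_induct) auto

lemma deriv_list_const_mult [simp]:
  "deriv_list is (const_poly c * f) = const_poly c * deriv_list is f"
  by (induction "is") auto

text \<open>Multiplicity at least \<open>k\<close>. Unlike equality in \<open>order_at\<close>, this
  is a set of linear equations in the coefficients of \<open>f\<close>.\<close>

definition vanish_order :: "nat \<Rightarrow> 'v cpoly \<Rightarrow> ('v \<Rightarrow> complex) \<Rightarrow> bool" where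
  "vanish_order k f p \<longleftrightarrow> (\<forall>is. length is < k \<longrightarrow> eval_poly (deriv_list is f) p = 0)"

lemma vanish_order_0 [simp]: "vanish_order 0 f p"
  by (simp add: vanish_order_def)

lemma vanish_order_Suc:
  "vanish_order (Suc k) f p \<longleftrightarrow> eval_poly f p = 0 \<and> (\<forall>v. vanish_order k (partial_deriv v f) p)"
  (is "?L \<longleftrightarrow> ?R")
proof
  assume L: ?L
  have "eval_poly f p = 0"
    using L[unfolded vanish_order_def, rule_format, of "[]"] by simp
  moreover have "vanish_order k (partial_deriv v f) p" for v
    unfolding vanish_order_def
  proof (intro allI impI)
    fix "is" :: "'a list" assume "length is < k"
    \<comment> \<open>\<open>foldr\<close> applies the last list entry first, so appending
      \<open>v\<close> differentiates by \<open>v\<close> before everything else.\<close>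
    then show "eval_poly (deriv_list is (partial_deriv v f)) p = 0"
      using L[unfolded vanish_order_def, rule_format, of "is @ [v]"] by simp
  qed
  ultimately show ?R by simp
next
  assume R: ?R
  show ?L
    unfolding vanish_order_def
  proof (intro allI impI)
    fix "is" :: "'a list" assume "length is < Suc k"
    then show "eval_poly (deriv_list is f) p = 0"
      using R by (cases "is" rule: rev_cases) (auto simp: vanish_order_def)
  qed
qed

lemma vanish_order_add:
  "vanish_order k f p \<Longrightarrow> vanish_order k g p \<Longrightarrow> vanish_order k (f + g) (p :: 'v::finite \<Rightarrow> _)"
  by (simp add: vanish_order_def)

text \<open>By the Leibniz rule the terms of a derivative of \<open>f * g\<close> have as second
  factor \<open>g\<close> or a derivative of \<open>g\<close>; both vanish to order one less than
  \<open>g\<close> was assumed to.\<close>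

lemma vanish_order_mult_right:
  "vanish_order k g p \<Longrightarrow> vanish_order k (f * g) (p :: 'v::finite \<Rightarrow> _)"
proof (induction k arbitrary: f g)
  case (Suc k)
  have "vanish_order k g p"
    using Suc.prems by (simp add: vanish_order_def)
  then show ?case
    using Suc by (auto simp: vanish_order_Suc[of k] partial_deriv_mult intro!: vanish_order_add)
qed simp

text \<open>Differentiating \<open>f\<close> leaves \<open>g\<close> intact; differentiating
  \<open>g\<close> costs one order, which the remaining factor \<open>f\<close> restores by
  induction.\<close>

lemma vanish_order_mult_Suc:
  "eval_poly f p = 0 \<Longrightarrow> vanish_order k g p \<Longrightarrow> vanish_order (Suc k) (f * g) (p :: 'v::finite \<Rightarrow> _)"
proof (induction k arbitrary: g)
  case 0
  then show ?case by (simp add: vanish_order_Suc)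
next
  case (Suc k)
  have "vanish_order (Suc k) (partial_deriv v (f * g)) p" for v
    unfolding partial_deriv_mult
    using Suc.prems(2) iffD1[OF vanish_order_Suc, OF Suc.prems(2)]
    by (intro vanish_order_add[OF vanish_order_mult_right Suc.IH[OF Suc.prems(1)]]) auto
  then show ?case using Suc.prems by (subst vanish_order_Suc) auto
qed

lemma vanish_order_power:
  "eval_poly f p = 0 \<Longrightarrow> vanish_order k (f ^ k) (p :: 'v::finite \<Rightarrow> _)"
  by (induction k) (auto intro: vanish_order_mult_Suc)

lemma order_at_const_mult:
  "c \<noteq> 0 \<Longrightarrow> order_at (const_poly c * f) p = order_at f (p :: 'v::finite \<Rightarrow> _)"
  by (simp add: order_at_def)

text \<open>Below a \<open>LEAST\<close> value the predicate fails whether or not it is satisfiable,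
  so this covers the zero polynomial too.\<close>

lemma vanish_order_order_at: "vanish_order (order_at f p) f p"
  unfolding vanish_order_def order_at_def by (blast dest: not_less_Least)

lemma order_at_eqI:
  assumes "vanish_order k f p" "eval_poly (deriv_list is f) p \<noteq> 0" "length is = k"
  shows "order_at f p = k"
  unfolding order_at_def
  by (rule Least_equality) (use assms in \<open>auto simp: vanish_order_def not_less[symmetric]\<close>)

section \<open>Homogeneous polynomials and Euler's relation\<close>

definition mdeg :: "('v::finite \<Rightarrow>\<^sub>0 nat) \<Rightarrow> nat" where
  "mdeg m = (\<Sum>v\<in>UNIV. lk m v)"

lemma mdeg_add [simp]: "mdeg (m + n) = mdeg m + mdeg n"
  by (simp add: mdeg_def lookup_add sum.distrib)

lemma mdeg_single [simp]: "mdeg (sg v k) = k"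
  by (simp add: mdeg_def lookup_single when_def)

lemma homogeneous_iff: "homogeneous d f \<longleftrightarrow> (\<forall>m. lk f m \<noteq> 0 \<longrightarrow> mdeg m = d)"
  by (auto simp: homogeneous_def mdeg_def in_keys_iff)

lemma homogeneous_add: "homogeneous d f \<Longrightarrow> homogeneous d g \<Longrightarrow> homogeneous d (f + g)"
  unfolding homogeneous_iff lookup_add by (metis add.left_neutral)

lemma homogeneous_zero [simp]: "homogeneous d 0"
  by (simp add: homogeneous_iff)

lemma homogeneous_sum: "(\<And>a. a \<in> A \<Longrightarrow> homogeneous d (f a)) \<Longrightarrow> homogeneous d (sum f A)"
  by (induction A rule: infinite_finite_induct) (auto intro: homogeneous_add)

lemma homogeneous_single [simp]: "homogeneous (mdeg m) (sg m c)"
  by (auto simp: homogeneous_iff lookup_single when_def)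

lemma homogeneous_mult:
  fixes f g :: "'v::finite cpoly"
  assumes "homogeneous d f" "homogeneous e g"
  shows "homogeneous (d + e) (f * g)"
  unfolding homogeneous_def
proof
  fix m assume "m \<in> Poly_Mapping.keys (f * g)"
  then obtain a b where "a \<in> Poly_Mapping.keys f" "b \<in> Poly_Mapping.keys g" "m = a + b"
    using keys_mult[of f g] by blast
  then show "sum (lk m) UNIV = d + e"
    using assms by (simp add: homogeneous_def lookup_add sum.distrib)
qed

lemma homogeneous_const [simp]: "homogeneous 0 (const_poly c)"
  using homogeneous_single[of 0 c] by (simp add: const_poly_def mdeg_def)

lemma homogeneous_const_mult: "homogeneous d f \<Longrightarrow> homogeneous d (const_poly c * f)"
  using homogeneous_mult[of 0 "const_poly c" d f] by simp

lemma homogeneous_power: "homogeneous d f \<Longrightarrow> homogeneous (n * d) (f ^ n)"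
proof (induction n)
  case 0
  show ?case using homogeneous_single[of 0 1] by (simp add: mdeg_def)
qed (auto intro: homogeneous_mult)

lemma homogeneous_partial_deriv: "homogeneous d f \<Longrightarrow> homogeneous (d - 1) (partial_deriv v f)"
  by (fastforce simp: homogeneous_iff lookup_partial_deriv)

lemma homogeneous_deriv_list: "homogeneous d f \<Longrightarrow> homogeneous (d - length is) (deriv_list is f)"
proof (induction "is")
  case (Cons v "is")
  then show ?case using homogeneous_partial_deriv[of "d - length is"] by simp
qed simp

lemma mon_eval_scale: "mon_eval m (\<lambda>v. c * x v) = c ^ mdeg m * mon_eval m x"
  by (simp add: mon_eval_def mdeg_def power_mult_distrib prod.distrib power_sum)

lemma homogeneous_scale:
  "homogeneous d f \<Longrightarrow> eval_poly f (\<lambda>v. c * x v) = c ^ d * eval_poly f x"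
  by (auto simp: eval_poly_mon mon_eval_scale homogeneous_iff in_keys_iff sum_distrib_left intro!: sum.cong)

text \<open>Multiplying the derivative of a monomial by \<open>x v\<close> restores the monomial
  with its exponent as factor. In positive degree a vanishing gradient thus forces a vanishing
  value, so a double point costs four equations instead of five.\<close>

lemma euler:
  assumes "homogeneous d f"
  shows "(\<Sum>v\<in>UNIV. x v * eval_poly (partial_deriv v f) x) = of_nat d * eval_poly f x"
proof -
  have *: "x v * (of_nat (lk m v) * lk f m * mon_eval (m - sg v 1) x) = of_nat (lk m v) * (lk f m * mon_eval m x)"
    for m v
  proof (cases "lk m v = 0")
    case False
    have "m = (m - sg v 1) + sg v 1"
      by (rule poly_mapping_eqI) (use False in \<open>auto simp: lookup_add lookup_minus lookup_single when_def\<close>)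
    then have "mon_eval m x = mon_eval (m - sg v 1) x * x v"
      by (metis mon_eval_add mon_eval_single power_one_right)
    then show ?thesis by simp
  qed simp
  have "(\<Sum>v\<in>UNIV. x v * eval_poly (partial_deriv v f) x)
      = (\<Sum>v\<in>UNIV. \<Sum>m\<in>Poly_Mapping.keys f. of_nat (lk m v) * (lk f m * mon_eval m x))"
    by (simp add: partial_deriv_def eval_poly_sum sum_distrib_left * del: One_nat_def)
  also have "\<dots> = (\<Sum>m\<in>Poly_Mapping.keys f. of_nat (mdeg m) * (lk f m * mon_eval m x))"
    by (subst sum.swap) (simp add: mdeg_def sum_distrib_right)
  also have "\<dots> = (\<Sum>m\<in>Poly_Mapping.keys f. of_nat d * (lk f m * mon_eval m x))"
    using assms by (intro sum.cong) (auto simp: homogeneous_iff in_keys_iff)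
  finally show ?thesis by (simp add: eval_poly_mon sum_distrib_left)
qed

text \<open>Derivatives of a form are forms, so their vanishing does not depend on the
  representative of a projective point.\<close>

lemma deriv_list_scale:
  assumes "homogeneous d f" "c \<noteq> 0"
  shows "eval_poly (deriv_list is f) (\<lambda>v. c * x v) = 0 \<longleftrightarrow> eval_poly (deriv_list is f) x = 0"
  using homogeneous_scale[OF homogeneous_deriv_list[OF assms(1)]] assms(2) by simp

subsection \<open>Linear systems depending on a triple of points\<close>

definition tri_degree :: "(4 + 4 + 4 \<Rightarrow>\<^sub>0 nat) \<Rightarrow> nat \<times> nat \<times> nat" where
  "tri_degree m = (\<Sum>i\<in>UNIV. lk m (Inl i), \<Sum>i\<in>UNIV. lk m (Inr (Inl i)), \<Sum>i\<in>UNIV. lk m (Inr (Inr i)))"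

lemma tri_degree_add: "tri_degree (m + n) = tri_degree m + tri_degree n"
  by (simp add: tri_degree_def lookup_add sum.distrib)

text \<open>Closure properties are stated for functions, so that the pivots produced by elimination
  are plain arithmetic expressions; the polynomial behind them is recovered only when the open set
  is defined.\<close>

definition trihom_fun :: "nat \<times> nat \<times> nat \<Rightarrow> ((4 + 4 + 4 \<Rightarrow> complex) \<Rightarrow> complex) \<Rightarrow> bool" where
  "trihom_fun d \<phi> \<longleftrightarrow>
     (\<exists>f. trihomogeneous (fst d) (fst (snd d)) (snd (snd d)) f \<and> \<phi> = eval_poly f)"

lemma trihomogeneous_iff:
  "trihomogeneous a b c f \<longleftrightarrow> (\<forall>m. lk f m \<noteq> 0 \<longrightarrow> tri_degree m = (a, b, c))"
  by (auto simp: trihomogeneous_def tri_degree_def in_keys_iff)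

lemma trihom_fun_iff:
  "trihom_fun d \<phi> \<longleftrightarrow> (\<exists>f. (\<forall>m. lk f m \<noteq> 0 \<longrightarrow> tri_degree m = d) \<and> \<phi> = eval_poly f)"
  by (simp add: trihom_fun_def trihomogeneous_iff)

lemma trihom_fun_single: "trihom_fun (tri_degree m) (\<lambda>x. c * mon_eval m x)"
  unfolding trihom_fun_iff
  by (rule exI[of _ "sg m c"]) (auto simp: lookup_single when_def)

lemma trihom_fun_const: "trihom_fun 0 (\<lambda>x. c)"
  using trihom_fun_single[of 0 c] by (simp add: tri_degree_def zero_prod_def)

lemma trihom_fun_zero: "trihom_fun d (\<lambda>x. 0)"
  unfolding trihom_fun_iff by (rule exI[of _ 0]) auto

lemma trihom_fun_var:
  "trihom_fun (1, 0, 0) (\<lambda>x. x (Inl i))"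
  "trihom_fun (0, 1, 0) (\<lambda>x. x (Inr (Inl i)))"
  "trihom_fun (0, 0, 1) (\<lambda>x. x (Inr (Inr i)))"
  using trihom_fun_single[of "sg (Inl i) 1" 1] trihom_fun_single[of "sg (Inr (Inl i)) 1" 1]
    trihom_fun_single[of "sg (Inr (Inr i)) 1" 1]
  by (simp_all add: mon_eval_single tri_degree_def lookup_single when_def)

lemma trihom_fun_add:
  assumes "trihom_fun d \<phi>" "trihom_fun d \<psi>"
  shows "trihom_fun d (\<lambda>x. \<phi> x + \<psi> x)"
proof -
  obtain f g where "\<forall>m. lk f m \<noteq> 0 \<longrightarrow> tri_degree m = d" "\<phi> = eval_poly f"
    "\<forall>m. lk g m \<noteq> 0 \<longrightarrow> tri_degree m = d" "\<psi> = eval_poly g"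
    using assms unfolding trihom_fun_iff by blast
  moreover from this have "tri_degree m = d" if "lk (f + g) m \<noteq> 0" for m
    using that by (cases "lk f m = 0") (auto simp: lookup_add)
  ultimately show ?thesis
    unfolding trihom_fun_iff by (intro exI[of _ "f + g"]) auto
qed

lemma trihom_fun_mult:
  assumes "trihom_fun d \<phi>" "trihom_fun e \<psi>"
  shows "trihom_fun (d + e) (\<lambda>x. \<phi> x * \<psi> x)"
proof -
  obtain f g where f: "\<forall>m. lk f m \<noteq> 0 \<longrightarrow> tri_degree m = d" "\<phi> = eval_poly f"
    and g: "\<forall>m. lk g m \<noteq> 0 \<longrightarrow> tri_degree m = e" "\<psi> = eval_poly g"
    using assms unfolding trihom_fun_iff by blast
  have "tri_degree m = d + e" if "lk (f * g) m \<noteq> 0" for m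
  proof -
    have "m \<in> Poly_Mapping.keys (f * g)" using that by (simp add: in_keys_iff)
    from subsetD[OF keys_mult this]
    obtain a b where "a \<in> Poly_Mapping.keys f" "b \<in> Poly_Mapping.keys g" "m = a + b" by blast
    then show ?thesis
      using f(1) g(1) by (simp add: tri_degree_add in_keys_iff)
  qed
  then show ?thesis
    unfolding trihom_fun_iff f g by (intro exI[of _ "f * g"]) auto
qed

lemma trihom_fun_cmult: "trihom_fun d \<phi> \<Longrightarrow> trihom_fun d (\<lambda>x. c * \<phi> x)"
  using trihom_fun_mult[OF trihom_fun_const[of c]] by simp

lemma trihom_fun_diff:
  "trihom_fun d \<phi> \<Longrightarrow> trihom_fun d \<psi> \<Longrightarrow> trihom_fun d (\<lambda>x. \<phi> x - \<psi> x)"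
  using trihom_fun_add[OF _ trihom_fun_cmult[of d \<psi> "- 1"]] by simp

lemma trihom_fun_sum:
  "(\<And>a. a \<in> A \<Longrightarrow> trihom_fun d (\<phi> a)) \<Longrightarrow> trihom_fun d (\<lambda>x. \<Sum>a\<in>A. \<phi> a x)"
  by (induction A rule: infinite_finite_induct) (auto intro: trihom_fun_zero trihom_fun_add)

lemma trihom_fun_prod:
  "(\<And>a. a \<in> A \<Longrightarrow> trihom_fun (d a) (\<phi> a)) \<Longrightarrow> trihom_fun (\<Sum>a\<in>A. d a) (\<lambda>x. \<Prod>a\<in>A. \<phi> a x)"
  by (induction A rule: infinite_finite_induct) (auto intro: trihom_fun_const trihom_fun_mult)

text \<open>The degree is a repeated sum of \<open>d\<close>, as triples of degrees are only added
  here.\<close>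

lemma trihom_fun_power: "trihom_fun d \<phi> \<Longrightarrow> trihom_fun (\<Sum>i<n. d) (\<lambda>x. \<phi> x ^ n)"
  using trihom_fun_prod[of "{..<n}" "\<lambda>_. d" "\<lambda>_. \<phi>"] by simp

text \<open>The map \<iota> inserts one factor's coordinates. A monomial of degree \<open>k\<close>
  becomes a product of \<open>k\<close> coordinate functions of the same degree
  \<open>d\<close>.\<close>

lemma trihom_fun_homogeneous:
  fixes f :: "4 cpoly"
  assumes f: "homogeneous k f" and \<iota>: "\<And>v. trihom_fun d (\<lambda>x. x (\<iota> v))"
  shows "trihom_fun (\<Sum>i<k. d) (\<lambda>x. eval_poly f (\<lambda>v. x (\<iota> v)))"
  unfolding eval_poly_mon
proof (intro trihom_fun_sum trihom_fun_cmult)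
  fix m assume "m \<in> Poly_Mapping.keys f"
  then have m: "mdeg m = k" using f by (auto simp: homogeneous_iff in_keys_iff)
  have "trihom_fun (\<Sum>v\<in>UNIV. \<Sum>i<lk m v. d) (\<lambda>x. mon_eval m (\<lambda>v. x (\<iota> v)))"
    unfolding mon_eval_def by (intro trihom_fun_prod trihom_fun_power \<iota>)
  also have "(\<Sum>v\<in>UNIV. \<Sum>i<lk m v. d) = (\<Sum>i<k. d)"
  proof -
    obtain a b c where "d = (a, b, c)" by (cases d)
    then show ?thesis by (simp add: m[symmetric] mdeg_def sum_distrib_right sum_prod)
  qed
  finally show "trihom_fun (\<Sum>i<k. d) (\<lambda>x. mon_eval m (\<lambda>v. x (\<iota> v)))" .
qed

text \<open>The polynomial \<open>g\<close> is the product of the pivots of a fraction-free elimination at \<open>x0\<close>.\<close>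

lemma trivial_kernel_open:
  fixes R :: "('j \<Rightarrow> (4 + 4 + 4 \<Rightarrow> complex) \<Rightarrow> complex) set"
  assumes "finite J" "\<And>r. r \<in> R \<Longrightarrow> \<exists>d. \<forall>j\<in>J. trihom_fun d (r j)"
    and "\<And>c. \<forall>r\<in>R. (\<Sum>j\<in>J. c j * r j x0) = 0 \<Longrightarrow> \<forall>j\<in>J. c j = 0"
  shows "\<exists>g d. trihom_fun d g \<and> g x0 \<noteq> 0 \<and>
    (\<forall>x. g x \<noteq> 0 \<longrightarrow> (\<forall>c. (\<forall>r\<in>R. (\<Sum>j\<in>J. c j * r j x) = 0) \<longrightarrow> (\<forall>j\<in>J. c j = 0)))"
  using assms
proof (induction J arbitrary: R)
  case empty
  show ?case
    using trihom_fun_const[of 1] by (intro exI[of _ "\<lambda>_. 1"] exI[of _ 0]) auto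
next
  case (insert j J)
  \<comment> \<open>If the column of \<open>j\<close> vanished at \<open>x0\<close>, the unit vector
    at \<open>j\<close> would be a nonzero kernel vector.\<close>
  have "\<exists>r\<in>R. r j x0 \<noteq> 0"
  proof (rule ccontr)
    assume "\<not> ?thesis"
    then have "\<forall>r\<in>R. (\<Sum>i\<in>insert j J. (if i = j then 1 else 0) * r i x0) = 0"
      using insert.hyps by (simp add: if_distrib[of "\<lambda>z. z * _"] cong: if_cong)
    from insert.prems(2)[OF this] show False by simp
  qed
  then obtain r where r: "r \<in> R" "r j x0 \<noteq> 0" by blast
  \<comment> \<open>Cross-multiplication eliminates the unknown \<open>j\<close> with pivot
    \<open>r j\<close>. Avoiding division keeps the entries trihomogeneous, of degree the sum of the
    two row degrees.\<close>
  define el where "el s i x = r j x * s i x - s j x * r i x" for s :: "'j \<Rightarrow> _" and i x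
  have el_sum: "(\<Sum>i\<in>J. c i * el s i x) =
      r j x * (\<Sum>i\<in>J. c i * s i x) - s j x * (\<Sum>i\<in>J. c i * r i x)" for c s x
    by (simp add: el_def sum_distrib_left sum_subtractf algebra_simps)
  obtain dr where dr: "\<forall>i\<in>insert j J. trihom_fun dr (r i)"
    using insert.prems(1) r by blast
  have "\<exists>g d. trihom_fun d g \<and> g x0 \<noteq> 0 \<and>
    (\<forall>x. g x \<noteq> 0 \<longrightarrow> (\<forall>c. (\<forall>r\<in>el ` R. (\<Sum>j\<in>J. c j * r j x) = 0) \<longrightarrow> (\<forall>j\<in>J. c j = 0)))"
  proof (rule insert.IH)
    fix s assume "s \<in> el ` R"
    then obtain s' where s': "s' \<in> R" "s = el s'" by blast
    obtain ds where ds: "\<forall>i\<in>insert j J. trihom_fun ds (s' i)"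
      using insert.prems(1) s' by blast
    have "trihom_fun (dr + ds) (s i)" if "i \<in> J" for i
      unfolding s' el_def
      using trihom_fun_mult[of dr "r j" ds "s' i"] trihom_fun_mult[of ds "s' j" dr "r i"] dr ds that
      by (auto intro!: trihom_fun_diff simp: add.commute)
    then show "\<exists>d. \<forall>i\<in>J. trihom_fun d (s i)" by blast
  next
    fix c assume c: "\<forall>s\<in>el ` R. (\<Sum>i\<in>J. c i * s i x0) = 0"
    \<comment> \<open>Solving row \<open>r\<close> for the unknown \<open>j\<close> extends a kernel
      vector of the reduced system to one of the original system.\<close>
    define c' where "c' = c(j := - (\<Sum>i\<in>J. c i * r i x0) / r j x0)"
    have cj: "r j x0 * c' j = - (\<Sum>i\<in>J. c i * r i x0)"
      using r(2) by (simp add: c'_def)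
    have sum_c': "(\<Sum>i\<in>J. c' i * s i x0) = (\<Sum>i\<in>J. c i * s i x0)" for s
      using insert.hyps by (intro sum.cong) (auto simp: c'_def)
    have "(\<Sum>i\<in>insert j J. c' i * s i x0) = 0" if "s \<in> R" for s
    proof -
      have "r j x0 * (\<Sum>i\<in>insert j J. c' i * s i x0) = (\<Sum>i\<in>J. c i * el s i x0)"
        unfolding el_sum sum.insert[OF insert.hyps] sum_c' distrib_left
        using cj by (simp add: mult.assoc[symmetric])
      also have "\<dots> = 0" using c that by blast
      finally show ?thesis using r(2) by simp
    qed
    then have "\<forall>i\<in>insert j J. c' i = 0" using insert.prems(2) by blast
    moreover have "c' i = c i" if "i \<in> J" for i using insert.hyps that by (auto simp: c'_def)
    ultimately show "\<forall>i\<in>J. c i = 0" by auto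
  qed
  then obtain g d where g: "trihom_fun d g" "g x0 \<noteq> 0"
    "\<And>x c i. g x \<noteq> 0 \<Longrightarrow> \<forall>r\<in>el ` R. (\<Sum>j\<in>J. c j * r j x) = 0 \<Longrightarrow> i \<in> J \<Longrightarrow> c i = 0"
    by blast
  have "\<forall>i\<in>insert j J. c i = 0"
    if x: "r j x * g x \<noteq> 0" and c: "\<forall>s\<in>R. (\<Sum>i\<in>insert j J. c i * s i x) = 0" for x c
  proof -
    have J: "(\<Sum>i\<in>J. c i * s i x) = - c j * s j x" if "s \<in> R" for s
      using c that insert.hyps by (simp add: eq_neg_iff_add_eq_0 add.commute)
    have "\<forall>s\<in>el ` R. (\<Sum>i\<in>J. c i * s i x) = 0"
      using J r(1) by (auto simp: el_sum)
    then have "\<forall>i\<in>J. c i = 0" using g(3)[of x] x by auto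
    moreover from this have "c j = 0" using J[OF r(1)] x by simp
    ultimately show ?thesis by blast
  qed
  moreover have "trihom_fun (dr + d) (\<lambda>x. r j x * g x)"
    using dr g(1) by (intro trihom_fun_mult) auto
  ultimately show ?case
    using r(2) g(2) by (intro exI[of _ "\<lambda>x. r j x * g x"] exI[of _ "dr + d"]) auto
qed

text \<open>Solving one equation with a nonzero coefficient removes one equation and one unknown,
  which preserves the strict inequality of cardinalities.\<close>

lemma underdetermined_system:
  fixes a :: "'i \<Rightarrow> 'j \<Rightarrow> complex"
  assumes "finite I" "finite J" "card I < card J"
  shows "\<exists>c. (\<exists>j\<in>J. c j \<noteq> 0) \<and> (\<forall>i\<in>I. (\<Sum>j\<in>J. c j * a i j) = 0)"
  using assms
proof (induction I arbitrary: J a)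
  case empty
  then have "J \<noteq> {}" by auto
  then show ?case by (intro exI[of _ "\<lambda>_. 1"]) auto
next
  case (insert i I)
  show ?case
  proof (cases "\<forall>j\<in>J. a i j = 0")
    case True
    then have z: "(\<Sum>j\<in>J. c j * a i j) = 0" for c by (intro sum.neutral) auto
    obtain c where "\<exists>j\<in>J. c j \<noteq> 0" "\<forall>k\<in>I. (\<Sum>j\<in>J. c j * a k j) = 0"
      using insert.IH[of J a] insert.hyps insert.prems by auto
    with z show ?thesis by (intro exI[of _ c]) auto
  next
    case False
    then obtain j where j: "j \<in> J" "a i j \<noteq> 0" by blast
    define K where "K = J - {j}"
    have K: "finite K" "j \<notin> K" "J = insert j K" "card I < card K"
    proof -
      show "finite K" "j \<notin> K" using insert.prems(1) by (auto simp: K_def)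
      show "J = insert j K" unfolding K_def using j(1) by blast
      show "card I < card K"
        using insert.hyps insert.prems card_Diff_singleton[OF j(1)] unfolding K_def
        by (simp add: card_insert_disjoint)
    qed
    obtain c where c: "\<exists>l\<in>K. c l \<noteq> 0"
      "\<forall>k\<in>I. (\<Sum>l\<in>K. c l * (a k l * a i j - a k j * a i l)) = 0"
      using insert.IH[OF K(1,4), of "\<lambda>k l. a k l * a i j - a k j * a i l"] by auto
    define c' where "c' = c(j := - (\<Sum>l\<in>K. c l * a i l) / a i j)"
    have sum_c': "(\<Sum>l\<in>K. c' l * a k l) = (\<Sum>l\<in>K. c l * a k l)" for k
      using K(2) by (intro sum.cong) (auto simp: c'_def)
    have cj: "c' j * a i j = - (\<Sum>l\<in>K. c l * a i l)"
      using j(2) by (simp add: c'_def)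
    have "(\<Sum>l\<in>J. c' l * a i l) = 0"
      unfolding K(3) sum.insert[OF K(1,2)] sum_c' cj by simp
    moreover have "(\<Sum>l\<in>J. c' l * a k l) = 0" if "k \<in> I" for k
    proof -
      have "(\<Sum>l\<in>K. c l * (a k l * a i j - a k j * a i l))
          = a i j * (\<Sum>l\<in>K. c l * a k l) - a k j * (\<Sum>l\<in>K. c l * a i l)"
        by (simp add: sum_distrib_left sum_subtractf right_diff_distrib mult_ac)
      also have "\<dots> = a i j * (\<Sum>l\<in>K. c l * a k l) + a k j * (c' j * a i j)"
        unfolding cj by simp
      also have "\<dots> = a i j * (\<Sum>l\<in>J. c' l * a k l)"
        unfolding K(3) sum.insert[OF K(1,2)] sum_c' by (simp add: algebra_simps)
      finally have "a i j * (\<Sum>l\<in>J. c' l * a k l) = (\<Sum>l\<in>K. c l * (a k l * a i j - a k j * a i l))"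
        by simp
      then show ?thesis using c(2) that j(2) by simp
    qed
    moreover have "\<exists>l\<in>J. c' l \<noteq> 0"
      using c(1) K(2,3) by (auto simp: c'_def)
    ultimately show ?thesis by (intro exI[of _ c']) auto
  qed
qed

subsection \<open>Sextics through the Klein configuration\<close>

lemma vector_4 [simp]:
  "(vector [x, y, z, w] :: 'a::zero ^ 4) $ 1 = x" "(vector [x, y, z, w] :: 'a ^ 4) $ 2 = y"
  "(vector [x, y, z, w] :: 'a ^ 4) $ 3 = z" "(vector [x, y, z, w] :: 'a ^ 4) $ 4 = w"
  by (simp_all add: vector_def)

lemma prod_4: "prod f (UNIV :: 4 set) = f 1 * f 2 * f 3 * f 4"
  unfolding UNIV_4 by (simp add: ac_simps)

section \<open>Coefficients of forms in four variables\<close>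

definition expo :: "nat \<Rightarrow> nat \<Rightarrow> nat \<Rightarrow> nat \<Rightarrow> (4 \<Rightarrow>\<^sub>0 nat)" where
  "expo a b c d = sg 1 a + sg 2 b + sg 3 c + sg 4 d"

lemma lookup_expo [simp]:
  "lk (expo a b c d) 1 = a" "lk (expo a b c d) 2 = b"
  "lk (expo a b c d) 3 = c" "lk (expo a b c d) 4 = d"
  by (simp_all add: expo_def lookup_add lookup_single when_def)

lemma expo_lookup: "expo (lk m 1) (lk m 2) (lk m 3) (lk m 4) = m"
proof (rule poly_mapping_eqI)
  show "lk (expo (lk m 1) (lk m 2) (lk m 3) (lk m 4)) v = lk m v" for v
    using exhaust_4[of v] by auto
qed

lemma mdeg_expo [simp]: "mdeg (expo a b c d) = a + b + c + d"
  by (simp add: mdeg_def sum_4)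

lemma mon_eval_expo: "mon_eval (expo a b c d) x = x 1 ^ a * x 2 ^ b * x 3 ^ c * x 4 ^ d"
  by (simp add: mon_eval_def prod_4)

lemma expo_add_single:
  "expo a b c d + sg 1 1 = expo (Suc a) b c d" "expo a b c d + sg 2 1 = expo a (Suc b) c d"
  "expo a b c d + sg 3 1 = expo a b (Suc c) d" "expo a b c d + sg 4 1 = expo a b c (Suc d)"
proof -
  have *: "m = n" if "\<forall>v. lk m v = lk n v" for m n :: "4 \<Rightarrow>\<^sub>0 nat"
    using that by (simp add: poly_mapping_eqI)
  show "expo a b c d + sg 1 1 = expo (Suc a) b c d" "expo a b c d + sg 2 1 = expo a (Suc b) c d"
    "expo a b c d + sg 3 1 = expo a b (Suc c) d" "expo a b c d + sg 4 1 = expo a b c (Suc d)"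
    by (rule *; simp add: forall_4 lookup_add lookup_single when_def)+
qed

lemma lookup_partial_deriv_expo:
  "lk (partial_deriv 1 f) (expo a b c d) = of_nat (Suc a) * lk f (expo (Suc a) b c d)"
  "lk (partial_deriv 2 f) (expo a b c d) = of_nat (Suc b) * lk f (expo a (Suc b) c d)"
  "lk (partial_deriv 3 f) (expo a b c d) = of_nat (Suc c) * lk f (expo a b (Suc c) d)"
  "lk (partial_deriv 4 f) (expo a b c d) = of_nat (Suc d) * lk f (expo a b c (Suc d))"
  by (simp_all only: lookup_partial_deriv expo_add_single lookup_expo Suc_eq_plus1)

text \<open>Exponents of total degree \<open>n\<close> by their first three entries; the bounds keep
  the fourth, \<open>n - a - b - c\<close>, from being truncated.\<close>

definition exps :: "nat \<Rightarrow> (nat \<times> nat \<times> nat) set" where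
  "exps n = (SIGMA a:{..n}. SIGMA b:{..n - a}. {..n - a - b})"

lemma finite_exps [simp]: "finite (exps n)"
  by (simp add: exps_def)

lemma sum_exps:
  "(\<Sum>(a, b, c)\<in>exps n. f a b c) = (\<Sum>a\<le>n. \<Sum>b\<le>n - a. \<Sum>c\<le>n - a - b. f a b c)"
proof -
  have "(\<Sum>(a, b, c)\<in>exps n. f a b c)
      = (\<Sum>a\<le>n. \<Sum>(b, c)\<in>(SIGMA b:{..n - a}. {..n - a - b}). f a b c)"
    unfolding exps_def by (rule sum.Sigma[symmetric]) auto
  also have "\<dots> = (\<Sum>a\<le>n. \<Sum>b\<le>n - a. \<Sum>c\<le>n - a - b. f a b c)"
    by (intro sum.cong refl sum.Sigma[symmetric]) auto
  finally show ?thesis .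
qed

lemma exps_image: "(\<lambda>(a, b, c). expo a b c (n - a - b - c)) ` exps n = {m. mdeg m = n}"
proof (intro equalityI subsetI)
  fix m :: "4 \<Rightarrow>\<^sub>0 nat" assume "m \<in> {m. mdeg m = n}"
  then have n: "lk m 1 + lk m 2 + lk m 3 + lk m 4 = n"
    by (simp add: mdeg_def sum_4)
  show "m \<in> (\<lambda>(a, b, c). expo a b c (n - a - b - c)) ` exps n"
    by (rule image_eqI[of _ _ "(lk m 1, lk m 2, lk m 3)"])
      (use n expo_lookup[of m] in \<open>auto simp: exps_def\<close>)
qed (auto simp: exps_def)

lemma finite_mdeg: "finite {m :: 4 \<Rightarrow>\<^sub>0 nat. mdeg m = n}"
  by (simp flip: exps_image)

lemma eval_homogeneous:
  assumes "homogeneous n f"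
  shows "eval_poly f x = (\<Sum>(a, b, c)\<in>exps n. lk f (expo a b c (n - a - b - c)) *
    (x 1 ^ a * x 2 ^ b * x 3 ^ c * x 4 ^ (n - a - b - c)))"
proof -
  have "inj_on (\<lambda>(a, b, c). expo a b c (n - a - b - c)) (exps n)"
    by (auto simp: inj_on_def) (metis lookup_expo)+
  moreover have "eval_poly f x = (\<Sum>m\<in>{m. mdeg m = n}. lk f m * mon_eval m x)"
    by (rule eval_poly_superset[OF finite_mdeg]) (use assms in \<open>auto simp: homogeneous_iff in_keys_iff\<close>)
  ultimately show ?thesis
    by (simp add: sum.reindex mon_eval_expo split_def flip: exps_image)
qed

lemma Suc_Suc_0: "Suc (Suc 0) = 2"
  by simp

lemmas sum_simps = sum_exps atMost_nat_numeral atMost_Suc Suc_Suc_0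

lemma homogeneous_eq_zero:
  assumes "homogeneous n f"
    and "\<forall>a\<in>{..n}. \<forall>b\<in>{..n - a}. \<forall>c\<in>{..n - a - b}. lk f (expo a b c (n - a - b - c)) = 0"
  shows "f = 0"
proof (rule poly_mapping_eqI)
  fix m
  show "lk f m = lk 0 m"
  proof (cases "mdeg m = n")
    case True
    then have "m \<in> (\<lambda>(a, b, c). expo a b c (n - a - b - c)) ` exps n" unfolding exps_image by simp
    then show ?thesis using assms(2) by (auto simp: exps_def)
  qed (use assms(1) in \<open>auto simp: homogeneous_iff\<close>)
qed

section \<open>Characters of the group of fourth roots of unity\<close>

definition mu4 :: "complex set" where "mu4 = {1, \<i>, - 1, - \<i>}"

lemma mu4_power_sum: "(\<Sum>\<beta>\<in>mu4. \<beta> ^ k) = (if 4 dvd k then 4 else 0)"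
proof -
  have "\<beta> ^ k = \<beta> ^ (k mod 4)" if "\<beta> \<in> mu4" for \<beta>
  proof -
    have "\<beta> ^ k = (\<beta> ^ 4) ^ (k div 4) * \<beta> ^ (k mod 4)"
      by (simp flip: power_mult power_add)
    moreover have "\<beta> ^ 4 = 1" using that by (auto simp: mu4_def)
    ultimately show ?thesis by simp
  qed
  then have "(\<Sum>\<beta>\<in>mu4. \<beta> ^ k) = (\<Sum>\<beta>\<in>mu4. \<beta> ^ (k mod 4))"
    by (rule sum.cong[OF refl])
  also have "\<dots> = 1 + \<i> ^ (k mod 4) + (- 1) ^ (k mod 4) + (- \<i>) ^ (k mod 4)"
    by (simp add: mu4_def complex_eq_iff)
  also have "\<dots> = (if k mod 4 = 0 then 4 else 0)"
  proof -
    have "j < 4 \<Longrightarrow> 1 + \<i> ^ j + (- 1) ^ j + (- \<i>) ^ j = (if j = 0 then 4 else 0)" for j :: nat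
      by (auto simp: less_Suc_eq numeral_eq_Suc)
    then show ?thesis by simp
  qed
  finally show ?thesis by (simp add: dvd_eq_mod_eq_0)
qed

text \<open>Summing over all triples projects onto the trivial character. Other characters are
  reached by shifting the exponents \<open>p\<close>, \<open>q\<close>, \<open>r\<close>
  beforehand.\<close>

lemma mu4_characters:
  assumes "\<And>\<beta> \<gamma> \<delta>. \<beta> \<in> mu4 \<Longrightarrow> \<gamma> \<in> mu4 \<Longrightarrow> \<delta> \<in> mu4 \<Longrightarrow>
    (\<Sum>m\<in>M. C m * \<beta> ^ p m * \<gamma> ^ q m * \<delta> ^ r m) = 0"
  shows "(\<Sum>m\<in>M. if 4 dvd p m \<and> 4 dvd q m \<and> 4 dvd r m then C m else 0) = 0"
proof -
  have "0 = (\<Sum>\<beta>\<in>mu4. \<Sum>\<gamma>\<in>mu4. \<Sum>\<delta>\<in>mu4. \<Sum>m\<in>M. C m * \<beta> ^ p m * \<gamma> ^ q m * \<delta> ^ r m)"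
    using assms by simp
  also have "\<dots> = (\<Sum>m\<in>M. \<Sum>\<beta>\<in>mu4. \<Sum>\<gamma>\<in>mu4. \<Sum>\<delta>\<in>mu4. C m * \<beta> ^ p m * \<gamma> ^ q m * \<delta> ^ r m)"
    by (simp only: sum.swap[of _ _ M])
  also have "\<dots> = (\<Sum>m\<in>M. C m * (\<Sum>\<beta>\<in>mu4. \<beta> ^ p m) * (\<Sum>\<gamma>\<in>mu4. \<gamma> ^ q m) * (\<Sum>\<delta>\<in>mu4. \<delta> ^ r m))"
    by (simp only: sum_distrib_left[symmetric] sum_distrib_right[symmetric])
  also have "\<dots> = 64 * (\<Sum>m\<in>M. if 4 dvd p m \<and> 4 dvd q m \<and> 4 dvd r m then C m else 0)"
    unfolding mu4_power_sum sum_distrib_left by (intro sum.cong) auto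
  finally show ?thesis by simp
qed

section \<open>Projective points and their coordinate vectors\<close>

lemma proportional_rep_abs:
  assumes "v \<noteq> 0"
  shows "\<exists>c. c \<noteq> 0 \<and> rep_P3 (abs_P3 v) = c *s v"
proof -
  have "proportional v v"
    using assms by (auto simp: proportional_def intro!: exI[of _ 1])
  then have "proportional v (rep_P3 (abs_P3 v))"
    using Quotient3_rep_abs[OF Quotient3_P3] part_equivp_symp[OF part_equivp_proportional] by blast
  then show ?thesis by (auto simp: proportional_def)
qed

lemma rep_P3_abs_P3_scale:
  assumes "v \<noteq> 0"
  obtains c where "c \<noteq> 0" "($) (rep_P3 (abs_P3 v)) = (\<lambda>i. c * v $ i)"
  using proportional_rep_abs[OF assms] by (auto simp: fun_eq_iff)

lemma eval_at_pt:
  assumes "homogeneous n f" "eval_poly f (($) (rep_P3 (pt x y z w))) = 0"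
    and nz: "x \<noteq> 0 \<or> y \<noteq> 0 \<or> z \<noteq> 0 \<or> w \<noteq> 0"
  shows "eval_poly f (($) (vector [x, y, z, w])) = 0"
proof -
  let ?v = "vector [x, y, z, w] :: complex ^ 4"
  have "?v \<noteq> 0" using nz by (auto simp: vec_eq_iff forall_4)
  then obtain c where "c \<noteq> 0" "($) (rep_P3 (pt x y z w)) = (\<lambda>i. c * ?v $ i)"
    unfolding pt_def by (rule rep_P3_abs_P3_scale)
  then show ?thesis
    using assms(2) homogeneous_scale[OF assms(1), of c "($) ?v"] by simp
qed

lemma pt_mu4_in_Z60:
  assumes "\<beta> \<in> mu4" "\<gamma> \<in> mu4" "\<delta> \<in> mu4" "(\<beta> * \<gamma> * \<delta>)\<^sup>2 = 1"
  shows "pt 1 \<beta> \<gamma> \<delta> \<in> Z60"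
  using assms unfolding mu4_def Z60_def
  by (auto simp: power2_eq_square)

lemma edge_pt_in_Z60:
  assumes "u \<in> mu4"
  shows "pt 1 u 0 0 \<in> Z60" "pt 1 0 u 0 \<in> Z60" "pt 1 0 0 u \<in> Z60"
    "pt 0 1 u 0 \<in> Z60" "pt 0 1 0 u \<in> Z60" "pt 0 0 1 u \<in> Z60"
  using assms unfolding mu4_def Z60_def by blast+

text \<open>The points \<open>[1:\<beta>:\<gamma>:\<delta>]\<close> of the configuration are those with \<open>\<beta>\<close>, \<open>\<gamma>\<close>, \<open>\<delta>\<close> fourth roots of
  unity and \<open>(\<beta>\<gamma>\<delta>)\<^sup>2 = 1\<close>, so \<open>(1 + (\<beta>\<gamma>\<delta>)\<^sup>2) F(1, \<beta>, \<gamma>, \<delta>)\<close> vanishes for all fourth roots of unity and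
  its character components give relations between the coefficients of \<open>F\<close>.\<close>

lemma sextic_relation:
  fixes F :: "4 cpoly"
  assumes F: "homogeneous 6 F" and Z: "\<And>z. z \<in> Z60 \<Longrightarrow> eval_poly F (($) (rep_P3 z)) = 0"
  shows "(\<Sum>(a, b, c)\<in>exps 6. let d = 6 - a - b - c in
      (if 4 dvd b + k \<and> 4 dvd c + l \<and> 4 dvd d + n then lk F (expo a b c d) else 0) +
      (if 4 dvd b + k + 2 \<and> 4 dvd c + l + 2 \<and> 4 dvd d + n + 2 then lk F (expo a b c d) else 0)) = 0"
proof -
  let ?d = "\<lambda>a b c. 6 - a - b - c :: nat"
  let ?C = "\<lambda>a b c. lk F (expo a b c (?d a b c))"
  have "(\<Sum>((a, b, c), e)\<in>exps 6 \<times> {0, 2}. ?C a b c * \<beta> ^ (b + k + e) * \<gamma> ^ (c + l + e) * \<delta> ^ (?d a b c + n + e)) = 0"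
    if "\<beta> \<in> mu4" "\<gamma> \<in> mu4" "\<delta> \<in> mu4" for \<beta> \<gamma> \<delta>
  proof -
    let ?t = "(\<beta> * \<gamma> * \<delta>)\<^sup>2"
    have "(1 + ?t) * eval_poly F (($) (vector [1, \<beta>, \<gamma>, \<delta>])) = 0"
    proof (cases "?t = 1")
      case True
      then show ?thesis
        using eval_at_pt[OF F Z[OF pt_mu4_in_Z60[OF that]]] by simp
    next
      case False
      moreover have "?t\<^sup>2 = 1" using that by (auto simp: mu4_def power_mult_distrib)
      then have "(?t - 1) * (1 + ?t) = 0" by algebra
      ultimately have "1 + ?t = 0" by simp
      then show ?thesis by (simp only: mult_zero_left)
    qed
    \<comment> \<open>This monomial moves the character with exponents -k, -l, -n modulo 4 to the
      trivial one.\<close>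
    then have "\<beta> ^ k * \<gamma> ^ l * \<delta> ^ n * ((1 + ?t) * eval_poly F (($) (vector [1, \<beta>, \<gamma>, \<delta>]))) = 0"
      by simp
    also have "\<beta> ^ k * \<gamma> ^ l * \<delta> ^ n * ((1 + ?t) * eval_poly F (($) (vector [1, \<beta>, \<gamma>, \<delta>])))
      = (\<Sum>(a, b, c)\<in>exps 6. \<Sum>e\<in>{0, 2}. ?C a b c * \<beta> ^ (b + k + e) * \<gamma> ^ (c + l + e) * \<delta> ^ (?d a b c + n + e))"
      unfolding eval_homogeneous[OF F] sum_distrib_left
      by (intro sum.cong) (auto simp: power_add power_mult_distrib algebra_simps)
    finally show ?thesis
      by (simp only: sum.cartesian_product' split_def fst_conv snd_conv)
  qed
  then have "(\<Sum>m\<in>exps 6 \<times> {0, 2}. if 4 dvd (case m of ((a, b, c), e) \<Rightarrow> b + k + e) \<and>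
      4 dvd (case m of ((a, b, c), e) \<Rightarrow> c + l + e) \<and> 4 dvd (case m of ((a, b, c), e) \<Rightarrow> ?d a b c + n + e)
      then (case m of ((a, b, c), e) \<Rightarrow> ?C a b c) else 0) = 0"
    by (intro mu4_characters) (simp add: split_def)
  then have "(\<Sum>m\<in>exps 6. \<Sum>e\<in>{0, 2}. case m of (a, b, c) \<Rightarrow>
      if 4 dvd b + k + e \<and> 4 dvd c + l + e \<and> 4 dvd ?d a b c + n + e then ?C a b c else 0) = 0"
    by (simp only: sum.cartesian_product' split_def fst_conv snd_conv)
  moreover have "(\<Sum>e\<in>{0, 2}. case m of (a, b, c) \<Rightarrow>
      if 4 dvd b + k + e \<and> 4 dvd c + l + e \<and> 4 dvd ?d a b c + n + e then ?C a b c else 0) =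
    (case m of (a, b, c) \<Rightarrow> let d = ?d a b c in
      (if 4 dvd b + k \<and> 4 dvd c + l \<and> 4 dvd d + n then lk F (expo a b c d) else 0) +
      (if 4 dvd b + k + 2 \<and> 4 dvd c + l + 2 \<and> 4 dvd d + n + 2 then lk F (expo a b c d) else 0))" for m
    by (simp add: Let_def split_def)
  ultimately show ?thesis by simp
qed

section \<open>Sixty linear relations between the coefficients\<close>

abbreviation (input) cf where "cf F a b c d \<equiv> lk F (expo a b c d)"

text \<open>Vanishing at the four roots means vanishing modulo u^4 - 1, so c0 + c4, c1 + c5, c2 + c6
  and c3 are zero.\<close>

lemma edge_relations:
  assumes "\<And>u. u \<in> mu4 \<Longrightarrow> c0 + c1 * u + c2 * u ^ 2 + c3 * u ^ 3 + c4 * u ^ 4 + c5 * u ^ 5 + c6 * u ^ 6 = 0"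
    and "c0 = 0" "c6 = 0"
  shows "c5 = - c1" "c2 = 0" "c3 = 0" "c4 = (0::complex)"
proof -
  have 1: "c1 + c2 + c3 + c4 + c5 = 0" "- c1 + c2 - c3 + c4 - c5 = 0"
    using assms(1)[of 1] assms(1)[of "- 1"] assms(2,3) by (simp_all add: mu4_def)
  have 2: "c1 * \<i> - c2 - c3 * \<i> + c4 + c5 * \<i> = 0" "- c1 * \<i> - c2 + c3 * \<i> + c4 - c5 * \<i> = 0"
    using assms(1)[of \<i>] assms(1)[of "- \<i>"] assms(2,3)
    by (simp_all add: mu4_def eval_nat_numeral algebra_simps)
  have 3: "c2 + c4 = 0" "c1 + c3 + c5 = 0" "c4 - c2 = 0" using 1 2 by algebra+
  show "c2 = 0" "c4 = 0" using 3 by algebra+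
  have "\<i> * (c1 - c3 + c5) = 0" using 2 by algebra
  then have "c1 - c3 + c5 = 0" by simp
  then show "c3 = 0" "c5 = - c1" using 3 by algebra+
qed

text \<open>Of the 84 coefficients 36 vanish and the other 48 form 24 pairs of opposite
  coefficients. These are 60 independent equations, and the 24 right-hand sides of the pairs are the
  free parameters.\<close>

lemma sextic_through_Z60:
  fixes F :: "4 cpoly"
  assumes F: "homogeneous 6 F" and Z: "\<And>z. z \<in> Z60 \<Longrightarrow> eval_poly F (($) (rep_P3 z)) = 0"
  shows "cf F 6 0 0 0 = 0"
    "cf F 0 6 0 0 = 0"
    "cf F 0 0 6 0 = 0"
    "cf F 0 0 0 6 = 0"
    "cf F 4 2 0 0 = 0"
    "cf F 3 3 0 0 = 0"
    "cf F 2 4 0 0 = 0"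
    "cf F 4 0 2 0 = 0"
    "cf F 3 0 3 0 = 0"
    "cf F 2 0 4 0 = 0"
    "cf F 4 0 0 2 = 0"
    "cf F 3 0 0 3 = 0"
    "cf F 2 0 0 4 = 0"
    "cf F 0 4 2 0 = 0"
    "cf F 0 3 3 0 = 0"
    "cf F 0 2 4 0 = 0"
    "cf F 0 4 0 2 = 0"
    "cf F 0 3 0 3 = 0"
    "cf F 0 2 0 4 = 0"
    "cf F 0 0 4 2 = 0"
    "cf F 0 0 3 3 = 0"
    "cf F 0 0 2 4 = 0"
    "cf F 1 1 2 2 = 0"
    "cf F 1 2 1 2 = 0"
    "cf F 1 2 2 1 = 0"
    "cf F 2 1 1 2 = 0"
    "cf F 2 1 2 1 = 0"
    "cf F 2 2 1 1 = 0"
    "cf F 0 2 2 2 = 0"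
    "cf F 3 1 1 1 = 0"
    "cf F 2 0 2 2 = 0"
    "cf F 1 3 1 1 = 0"
    "cf F 2 2 0 2 = 0"
    "cf F 1 1 3 1 = 0"
    "cf F 2 2 2 0 = 0"
    "cf F 1 1 1 3 = 0"
    "cf F 1 5 0 0 = - cf F 5 1 0 0"
    "cf F 1 0 5 0 = - cf F 5 0 1 0"
    "cf F 1 0 0 5 = - cf F 5 0 0 1"
    "cf F 0 1 5 0 = - cf F 0 5 1 0"
    "cf F 0 1 0 5 = - cf F 0 5 0 1"
    "cf F 0 0 1 5 = - cf F 0 0 5 1"
    "cf F 1 1 0 4 = - cf F 1 1 4 0"
    "cf F 1 3 0 2 = - cf F 3 1 2 0"
    "cf F 1 3 2 0 = - cf F 3 1 0 2"
    "cf F 1 0 1 4 = - cf F 1 4 1 0"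
    "cf F 1 0 3 2 = - cf F 3 2 1 0"
    "cf F 1 2 3 0 = - cf F 3 0 1 2"
    "cf F 1 0 4 1 = - cf F 1 4 0 1"
    "cf F 1 0 2 3 = - cf F 3 2 0 1"
    "cf F 1 2 0 3 = - cf F 3 0 2 1"
    "cf F 0 1 1 4 = - cf F 4 1 1 0"
    "cf F 0 1 3 2 = - cf F 2 3 1 0"
    "cf F 2 1 3 0 = - cf F 0 3 1 2"
    "cf F 0 1 4 1 = - cf F 4 1 0 1"
    "cf F 0 1 2 3 = - cf F 2 3 0 1"
    "cf F 2 1 0 3 = - cf F 0 3 2 1"
    "cf F 0 4 1 1 = - cf F 4 0 1 1"
    "cf F 0 2 1 3 = - cf F 2 0 3 1"
    "cf F 2 0 1 3 = - cf F 0 2 3 1"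
proof -
  have v0: "cf F 6 0 0 0 = 0"
    using eval_at_pt[OF F Z, of 1 0 0 0] by (simp add: Z60_def eval_homogeneous[OF F] sum_simps)
  have v1: "cf F 0 6 0 0 = 0"
    using eval_at_pt[OF F Z, of 0 1 0 0] by (simp add: Z60_def eval_homogeneous[OF F] sum_simps)
  have v2: "cf F 0 0 6 0 = 0"
    using eval_at_pt[OF F Z, of 0 0 1 0] by (simp add: Z60_def eval_homogeneous[OF F] sum_simps)
  have v3: "cf F 0 0 0 6 = 0"
    using eval_at_pt[OF F Z, of 0 0 0 1] by (simp add: Z60_def eval_homogeneous[OF F] sum_simps)
  \<comment> \<open>On the line through two coordinate points the sextic restricts to a binary form
    with seven coefficients, of which the outer two are already zero.\<close>
  have e: "cf F 6 0 0 0 + cf F 5 1 0 0 * u + cf F 4 2 0 0 * u ^ 2 + cf F 3 3 0 0 * u ^ 3 + cf F 2 4 0 0 * u ^ 4 + cf F 1 5 0 0 * u ^ 5 + cf F 0 6 0 0 * u ^ 6 = 0" if "u \<in> mu4" for u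
    using eval_at_pt[OF F Z, of 1 u 0 0] edge_pt_in_Z60[OF that]
    by (simp add: eval_homogeneous[OF F] sum_simps ac_simps)
  note e01 = edge_relations[OF e v0 v1]
  have e: "cf F 6 0 0 0 + cf F 5 0 1 0 * u + cf F 4 0 2 0 * u ^ 2 + cf F 3 0 3 0 * u ^ 3 + cf F 2 0 4 0 * u ^ 4 + cf F 1 0 5 0 * u ^ 5 + cf F 0 0 6 0 * u ^ 6 = 0" if "u \<in> mu4" for u
    using eval_at_pt[OF F Z, of 1 0 u 0] edge_pt_in_Z60[OF that]
    by (simp add: eval_homogeneous[OF F] sum_simps ac_simps)
  note e02 = edge_relations[OF e v0 v2]
  have e: "cf F 6 0 0 0 + cf F 5 0 0 1 * u + cf F 4 0 0 2 * u ^ 2 + cf F 3 0 0 3 * u ^ 3 + cf F 2 0 0 4 * u ^ 4 + cf F 1 0 0 5 * u ^ 5 + cf F 0 0 0 6 * u ^ 6 = 0" if "u \<in> mu4" for u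
    using eval_at_pt[OF F Z, of 1 0 0 u] edge_pt_in_Z60[OF that]
    by (simp add: eval_homogeneous[OF F] sum_simps ac_simps)
  note e03 = edge_relations[OF e v0 v3]
  have e: "cf F 0 6 0 0 + cf F 0 5 1 0 * u + cf F 0 4 2 0 * u ^ 2 + cf F 0 3 3 0 * u ^ 3 + cf F 0 2 4 0 * u ^ 4 + cf F 0 1 5 0 * u ^ 5 + cf F 0 0 6 0 * u ^ 6 = 0" if "u \<in> mu4" for u
    using eval_at_pt[OF F Z, of 0 1 u 0] edge_pt_in_Z60[OF that]
    by (simp add: eval_homogeneous[OF F] sum_simps ac_simps)
  note e12 = edge_relations[OF e v1 v2]
  have e: "cf F 0 6 0 0 + cf F 0 5 0 1 * u + cf F 0 4 0 2 * u ^ 2 + cf F 0 3 0 3 * u ^ 3 + cf F 0 2 0 4 * u ^ 4 + cf F 0 1 0 5 * u ^ 5 + cf F 0 0 0 6 * u ^ 6 = 0" if "u \<in> mu4" for u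
    using eval_at_pt[OF F Z, of 0 1 0 u] edge_pt_in_Z60[OF that]
    by (simp add: eval_homogeneous[OF F] sum_simps ac_simps)
  note e13 = edge_relations[OF e v1 v3]
  have e: "cf F 0 0 6 0 + cf F 0 0 5 1 * u + cf F 0 0 4 2 * u ^ 2 + cf F 0 0 3 3 * u ^ 3 + cf F 0 0 2 4 * u ^ 4 + cf F 0 0 1 5 * u ^ 5 + cf F 0 0 0 6 * u ^ 6 = 0" if "u \<in> mu4" for u
    using eval_at_pt[OF F Z, of 0 0 1 u] edge_pt_in_Z60[OF that]
    by (simp add: eval_homogeneous[OF F] sum_simps ac_simps)
  note e23 = edge_relations[OF e v2 v3]
  \<comment> \<open>Adding 2 to all three shifts modulo 4 gives the same relation, so the 64 classes
    yield 32 relations, represented by first shift 0 or 3; the shift 3 stands for -1.\<close>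
  have r0: "cf F 0 2 2 2 + cf F 2 0 0 4 + cf F 2 0 4 0 + cf F 2 4 0 0 + cf F 6 0 0 0 = 0"
    using sextic_relation[OF F Z, of 0 0 0] by (simp add: sum_simps Let_def ac_simps)
  have r1: "cf F 1 0 0 5 + cf F 1 0 4 1 + cf F 1 4 0 1 + cf F 5 0 0 1 = 0"
    using sextic_relation[OF F Z, of 0 0 3] by (simp add: sum_simps Let_def ac_simps)
  have r2: "cf F 0 0 0 6 + cf F 0 0 4 2 + cf F 0 4 0 2 + cf F 2 2 2 0 + cf F 4 0 0 2 = 0"
    using sextic_relation[OF F Z, of 0 0 2] by (simp add: sum_simps Let_def ac_simps)
  have r3: "cf F 1 2 2 1 + cf F 3 0 0 3 = 0"
    using sextic_relation[OF F Z, of 0 0 1] by (simp add: sum_simps Let_def ac_simps)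
  have r4: "cf F 1 0 1 4 + cf F 1 0 5 0 + cf F 1 4 1 0 + cf F 5 0 1 0 = 0"
    using sextic_relation[OF F Z, of 0 3 0] by (simp add: sum_simps Let_def ac_simps)
  have r5: "cf F 0 0 1 5 + cf F 0 0 5 1 + cf F 0 4 1 1 + cf F 4 0 1 1 = 0"
    using sextic_relation[OF F Z, of 0 3 3] by (simp add: sum_simps Let_def ac_simps)
  have r6: "cf F 1 2 3 0 + cf F 3 0 1 2 = 0"
    using sextic_relation[OF F Z, of 0 3 2] by (simp add: sum_simps Let_def ac_simps)
  have r7: "cf F 0 2 3 1 + cf F 2 0 1 3 = 0"
    using sextic_relation[OF F Z, of 0 3 1] by (simp add: sum_simps Let_def ac_simps)
  have r8: "cf F 0 0 2 4 + cf F 0 0 6 0 + cf F 0 4 2 0 + cf F 2 2 0 2 + cf F 4 0 2 0 = 0"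
    using sextic_relation[OF F Z, of 0 2 0] by (simp add: sum_simps Let_def ac_simps)
  have r9: "cf F 1 2 0 3 + cf F 3 0 2 1 = 0"
    using sextic_relation[OF F Z, of 0 2 3] by (simp add: sum_simps Let_def ac_simps)
  have r10: "cf F 0 2 0 4 + cf F 0 2 4 0 + cf F 0 6 0 0 + cf F 2 0 2 2 + cf F 4 2 0 0 = 0"
    using sextic_relation[OF F Z, of 0 2 2] by (simp add: sum_simps Let_def ac_simps)
  have r11: "cf F 1 0 2 3 + cf F 3 2 0 1 = 0"
    using sextic_relation[OF F Z, of 0 2 1] by (simp add: sum_simps Let_def ac_simps)
  have r12: "cf F 1 2 1 2 + cf F 3 0 3 0 = 0"
    using sextic_relation[OF F Z, of 0 1 0] by (simp add: sum_simps Let_def ac_simps)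
  have r13: "cf F 0 2 1 3 + cf F 2 0 3 1 = 0"
    using sextic_relation[OF F Z, of 0 1 3] by (simp add: sum_simps Let_def ac_simps)
  have r14: "cf F 1 0 3 2 + cf F 3 2 1 0 = 0"
    using sextic_relation[OF F Z, of 0 1 2] by (simp add: sum_simps Let_def ac_simps)
  have r15: "cf F 0 0 3 3 + cf F 2 2 1 1 = 0"
    using sextic_relation[OF F Z, of 0 1 1] by (simp add: sum_simps Let_def ac_simps)
  have r16: "cf F 1 1 0 4 + cf F 1 1 4 0 + cf F 1 5 0 0 + cf F 5 1 0 0 = 0"
    using sextic_relation[OF F Z, of 3 0 0] by (simp add: sum_simps Let_def ac_simps)
  have r17: "cf F 0 1 0 5 + cf F 0 1 4 1 + cf F 0 5 0 1 + cf F 4 1 0 1 = 0"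
    using sextic_relation[OF F Z, of 3 0 3] by (simp add: sum_simps Let_def ac_simps)
  have r18: "cf F 1 3 2 0 + cf F 3 1 0 2 = 0"
    using sextic_relation[OF F Z, of 3 0 2] by (simp add: sum_simps Let_def ac_simps)
  have r19: "cf F 0 3 2 1 + cf F 2 1 0 3 = 0"
    using sextic_relation[OF F Z, of 3 0 1] by (simp add: sum_simps Let_def ac_simps)
  have r20: "cf F 0 1 1 4 + cf F 0 1 5 0 + cf F 0 5 1 0 + cf F 4 1 1 0 = 0"
    using sextic_relation[OF F Z, of 3 3 0] by (simp add: sum_simps Let_def ac_simps)
  have r21: "cf F 3 1 1 1 = 0"
    using sextic_relation[OF F Z, of 3 3 3] by (simp add: sum_simps Let_def ac_simps)
  have r22: "cf F 0 3 3 0 + cf F 2 1 1 2 = 0"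
    using sextic_relation[OF F Z, of 3 3 2] by (simp add: sum_simps Let_def ac_simps)
  have r23: "cf F 1 1 1 3 = 0"
    using sextic_relation[OF F Z, of 3 3 1] by (simp add: sum_simps Let_def ac_simps)
  have r24: "cf F 1 3 0 2 + cf F 3 1 2 0 = 0"
    using sextic_relation[OF F Z, of 3 2 0] by (simp add: sum_simps Let_def ac_simps)
  have r25: "cf F 0 3 0 3 + cf F 2 1 2 1 = 0"
    using sextic_relation[OF F Z, of 3 2 3] by (simp add: sum_simps Let_def ac_simps)
  have r26: "cf F 1 1 2 2 + cf F 3 3 0 0 = 0"
    using sextic_relation[OF F Z, of 3 2 2] by (simp add: sum_simps Let_def ac_simps)
  have r27: "cf F 0 1 2 3 + cf F 2 3 0 1 = 0"
    using sextic_relation[OF F Z, of 3 2 1] by (simp add: sum_simps Let_def ac_simps)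
  have r28: "cf F 0 3 1 2 + cf F 2 1 3 0 = 0"
    using sextic_relation[OF F Z, of 3 1 0] by (simp add: sum_simps Let_def ac_simps)
  have r29: "cf F 1 1 3 1 = 0"
    using sextic_relation[OF F Z, of 3 1 3] by (simp add: sum_simps Let_def ac_simps)
  have r30: "cf F 0 1 3 2 + cf F 2 3 1 0 = 0"
    using sextic_relation[OF F Z, of 3 1 2] by (simp add: sum_simps Let_def ac_simps)
  have r31: "cf F 1 3 1 1 = 0"
    using sextic_relation[OF F Z, of 3 1 1] by (simp add: sum_simps Let_def ac_simps)
  show "cf F 6 0 0 0 = 0"
    by (rule v0)
  show "cf F 0 6 0 0 = 0"
    by (rule v1)
  show "cf F 0 0 6 0 = 0"
    by (rule v2)
  show "cf F 0 0 0 6 = 0"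
    by (rule v3)
  show "cf F 4 2 0 0 = 0"
    by (rule e01(2))
  show "cf F 3 3 0 0 = 0"
    by (rule e01(3))
  show "cf F 2 4 0 0 = 0"
    by (rule e01(4))
  show "cf F 4 0 2 0 = 0"
    by (rule e02(2))
  show "cf F 3 0 3 0 = 0"
    by (rule e02(3))
  show "cf F 2 0 4 0 = 0"
    by (rule e02(4))
  show "cf F 4 0 0 2 = 0"
    by (rule e03(2))
  show "cf F 3 0 0 3 = 0"
    by (rule e03(3))
  show "cf F 2 0 0 4 = 0"
    by (rule e03(4))
  show "cf F 0 4 2 0 = 0"
    by (rule e12(2))
  show "cf F 0 3 3 0 = 0"
    by (rule e12(3))
  show "cf F 0 2 4 0 = 0"
    by (rule e12(4))
  show "cf F 0 4 0 2 = 0"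
    by (rule e13(2))
  show "cf F 0 3 0 3 = 0"
    by (rule e13(3))
  show "cf F 0 2 0 4 = 0"
    by (rule e13(4))
  show "cf F 0 0 4 2 = 0"
    by (rule e23(2))
  show "cf F 0 0 3 3 = 0"
    by (rule e23(3))
  show "cf F 0 0 2 4 = 0"
    by (rule e23(4))
  show "cf F 1 1 2 2 = 0"
    using r26 e01 by algebra
  show "cf F 1 2 1 2 = 0"
    using r12 e02 by algebra
  show "cf F 1 2 2 1 = 0"
    using r3 e03 by algebra
  show "cf F 2 1 1 2 = 0"
    using r22 e12 by algebra
  show "cf F 2 1 2 1 = 0"
    using r25 e13 by algebra
  show "cf F 2 2 1 1 = 0"
    using r15 e23 by algebra
  show "cf F 0 2 2 2 = 0"
    using r0 e01 e02 e03 v0 by algebra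
  show "cf F 3 1 1 1 = 0"
    by (rule r21)
  show "cf F 2 0 2 2 = 0"
    using r10 e01 e12 e13 v1 by algebra
  show "cf F 1 3 1 1 = 0"
    by (rule r31)
  show "cf F 2 2 0 2 = 0"
    using r8 e02 e12 e23 v2 by algebra
  show "cf F 1 1 3 1 = 0"
    by (rule r29)
  show "cf F 2 2 2 0 = 0"
    using r2 e03 e13 e23 v3 by algebra
  show "cf F 1 1 1 3 = 0"
    by (rule r23)
  show "cf F 1 5 0 0 = - cf F 5 1 0 0"
    by (rule e01(1))
  show "cf F 1 0 5 0 = - cf F 5 0 1 0"
    by (rule e02(1))
  show "cf F 1 0 0 5 = - cf F 5 0 0 1"
    by (rule e03(1))
  show "cf F 0 1 5 0 = - cf F 0 5 1 0"
    by (rule e12(1))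
  show "cf F 0 1 0 5 = - cf F 0 5 0 1"
    by (rule e13(1))
  show "cf F 0 0 1 5 = - cf F 0 0 5 1"
    by (rule e23(1))
  show "cf F 1 1 0 4 = - cf F 1 1 4 0"
    using r16 e01 by algebra
  show "cf F 1 3 0 2 = - cf F 3 1 2 0"
    using r24  by algebra
  show "cf F 1 3 2 0 = - cf F 3 1 0 2"
    using r18  by algebra
  show "cf F 1 0 1 4 = - cf F 1 4 1 0"
    using r4 e02 by algebra
  show "cf F 1 0 3 2 = - cf F 3 2 1 0"
    using r14  by algebra
  show "cf F 1 2 3 0 = - cf F 3 0 1 2"
    using r6  by algebra
  show "cf F 1 0 4 1 = - cf F 1 4 0 1"
    using r1 e03 by algebra
  show "cf F 1 0 2 3 = - cf F 3 2 0 1"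
    using r11  by algebra
  show "cf F 1 2 0 3 = - cf F 3 0 2 1"
    using r9  by algebra
  show "cf F 0 1 1 4 = - cf F 4 1 1 0"
    using r20 e12 by algebra
  show "cf F 0 1 3 2 = - cf F 2 3 1 0"
    using r30  by algebra
  show "cf F 2 1 3 0 = - cf F 0 3 1 2"
    using r28  by algebra
  show "cf F 0 1 4 1 = - cf F 4 1 0 1"
    using r17 e13 by algebra
  show "cf F 0 1 2 3 = - cf F 2 3 0 1"
    using r27  by algebra
  show "cf F 2 1 0 3 = - cf F 0 3 2 1"
    using r19  by algebra
  show "cf F 0 4 1 1 = - cf F 4 0 1 1"
    using r5 e23 by algebra
  show "cf F 0 2 1 3 = - cf F 2 0 3 1"
    using r13  by algebra
  show "cf F 2 0 1 3 = - cf F 0 2 3 1"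
    using r7  by algebra
qed

subsection \<open>Uniqueness at a test triple\<close>

text \<open>The variables are the free coefficients of a sextic through the configuration: \<open>axy\<close>, \<open>bxy\<close>, \<open>cxy\<close>,
  \<open>dxy\<close> belong to \<open>x\<^sup>5y\<close>, \<open>xyz\<^sup>4\<close>, \<open>x\<^sup>3yz\<^sup>2\<close>, \<open>x\<^sup>3yw\<^sup>2\<close>, and similarly for the other pairs of coordinates.
  The equations say that the third derivatives vanish at \<open>[0:1:1:1]\<close> and the gradient vanishes at
  \<open>[1:0:1:1]\<close> and \<open>[1:-1:-1:0]\<close>.\<close>

lemma test_point_linear_system:
  fixes axy bxy cxy dxy axz bxz cxz dxz axw bxw cxw dxw ayz byz cyz dyz ayw byw cyw dyw azw bzw czw dzw :: complex
  assumes e0: "- 24 * byz - 60 * ayw - 6 * cyw - 60 * azw - 6 * czw = 0"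
    and e1: "- 12 * byz - 6 * cyz + 2 * dyz - 12 * cyw - 20 * azw - 6 * czw = 0"
    and e2: "- 12 * cyz - 12 * byw - 6 * cyw + 2 * dyw + 20 * azw + 6 * dzw = 0"
    and e3: "- 60 * ayz - 6 * cyz - 24 * byw + 60 * azw + 6 * dzw = 0"
    and e4: "- 12 * byz - 2 * cyz + 6 * dyz - 20 * ayw - 6 * cyw - 12 * czw = 0"
    and e5: "- 4 * byz - 6 * cyz + 6 * dyz - 4 * byw - 6 * cyw + 6 * dyw - 4 * bzw - 6 * czw + 6 * dzw = 0"
    and e6: "- 20 * ayz - 6 * cyz - 12 * byw - 2 * cyw + 6 * dyw + 12 * dzw = 0"
    and e7: "12 * dyz + 20 * ayw + 6 * dyw - 12 * bzw - 6 * czw + 2 * dzw = 0"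
    and e8: "20 * ayz + 6 * dyz + 12 * dyw - 12 * bzw - 2 * czw + 6 * dzw = 0"
    and e9: "60 * ayz + 6 * dyz + 60 * ayw + 6 * dyw - 24 * bzw = 0"
    and e10: "- 12 * bxy - 2 * cxy - 12 * bxz - 2 * cxz - 20 * axw - 6 * cxw - 6 * dxw = 0"
    and e11: "- 4 * bxz - 6 * cxz - 4 * bxw - 6 * cxw = 0"
    and e12: "12 * bxy - 2 * dxy - 20 * axz - 6 * cxz - 6 * dxz - 12 * bxw - 2 * cxw = 0"
    and e13: "- 4 * bxy - 6 * cxy + 4 * bxw - 6 * dxw = 0"
    and e14: "4 * bxy - 6 * dxy + 4 * bxz - 6 * dxz = 0"
    and e15: "- 20 * axy - 6 * cxy - 6 * dxy + 12 * bxz - 2 * dxz + 12 * bxw - 2 * dxw = 0"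
    and e16: "2 * cyw - 6 * dyw + 2 * czw - 6 * dzw = 0"
    and e17: "2 * cyz - 6 * dyz + 6 * czw - 2 * dzw = 0"
    and e18: "6 * cyz - 2 * dyz + 6 * cyw - 2 * dyw = 0"
    and e19: "6 * cxy + 6 * dxy + 6 * cxz + 6 * dxz + 6 * cxw + 6 * dxw = 0"
    and e20: "- 4 * bxz - 2 * cxz + 2 * dxz - 4 * axw - bxw - 3 * cxw + dxw - 4 * azw + bzw + czw - 3 * dzw = 0"
    and e21: "- 4 * axz - bxz - 3 * cxz + dxz - 4 * bxw - 2 * cxw + 2 * dxw + 4 * azw + bzw + 3 * czw - dzw = 0"
    and e22: "axy + cxy + dxy - ayz - cyz - dyz - ayw - cyw - dyw = 0"
    and e23: "4 * axz - bxz - cxz + 3 * dxz + 4 * axw - bxw - cxw + 3 * dxw + 4 * bzw + 2 * czw - 2 * dzw = 0"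
    and e24: "axw + cxw + dxw - ayw - cyw - dyw - azw - czw - dzw = 0"
    and e25: "4 * bxy + 2 * cxy - 2 * dxy - 4 * axz + bxz + cxz - 3 * dxz + 4 * ayz - byz - cyz + 3 * dyz = 0"
    and e26: "- 4 * axy + bxy + cxy - 3 * dxy + 4 * bxz + 2 * cxz - 2 * dxz - 4 * ayz - byz - 3 * cyz + dyz = 0"
    and e27: "- 4 * axy - bxy - 3 * cxy + dxy - 4 * axz - bxz - 3 * cxz + dxz + 4 * byz + 2 * cyz - 2 * dyz = 0"
  shows "axy = 0" "bxy = 0" "cxy = -dxw" "dxy = dxw" "axz = 0" "bxz = 0" "cxz = dxw" "dxz = -dxw" "axw = 0" "bxw = 0" "cxw = -dxw" "ayz = 0" "byz = 0" "cyz = 0" "dyz = 0" "ayw = 0" "byw = 0" "cyw = 0" "dyw = 0" "azw = 0" "bzw = 0" "czw = 0" "dzw = 0"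
proof -
  \<comment> \<open>Forward elimination: each line reduces one equation by the earlier ones and
    solves it for a new unknown, with denominators cleared; \<open>dxw\<close> stays free.\<close>
  have bxw: "2 * bxw = - 2 * bxz - 3 * cxz - 3 * cxw"
    using e11  by algebra
  have bxy: "2 * bxy = 3 * dxy - 2 * bxz + 3 * dxz"
    using e14  by algebra
  have cyw: "cyw = 3 * dyw - czw + 3 * dzw"
    using e16  by algebra
  have cyz: "cyz = 3 * dyz - 3 * czw + dzw"
    using e17  by algebra
  have ayw: "10 * ayw = - 6 * byz - 9 * dyw - 10 * dzw"
    using e4 cyw cyz by algebra
  have azw: "10 * azw = 2 * byz + 6 * dyw + 7 * dzw"
    using e0 cyw ayw by algebra
  have byw: "6 * byw = - 10 * ayz + 10 * czw - 9 * dyz"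
    using e6 cyw cyz by algebra
  have dyz: "2 * dyz = - 2 * dyw + 3 * czw - 3 * dzw"
    using e18 cyw cyz by algebra
  have byz: "byz = - 2 * dyw - 2 * dzw"
    using e1 cyw cyz azw dyz by algebra
  have bzw: "bzw = czw - dzw"
    using e7 ayw dyz byz by algebra
  have ayz: "20 * ayz = - 6 * dyw - 9 * dzw + 5 * czw"
    using e2 cyw cyz azw byw dyz byz by algebra
  have axz: "5 * axz = 4 * dxy + 3 * cxz + 3 * dxz + 4 * cxw"
    using e12 bxw bxy by algebra
  have axy: "4 * axy = - 4 * cxy - 4 * dxy + 9 * czw - 9 * dzw"
    using e22 cyw cyz ayw dyz byz ayz by algebra
  have axw: "2 * axw = - 2 * cxw - 2 * dxw + 9 * dyw + 9 * dzw"
    using e24 cyw ayw azw byz by algebra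
  have cxy: "cxy = - dxw - cxz - cxw - dxy - dxz"
    using e13 bxw bxy by algebra
  have dxy: "8 * dxy = 8 * cxw + 8 * dxw - 8 * dxz - 45 * dyw - 45 * dzw"
    using e10 bxy axw cxy by algebra
  have dxz: "16 * dxz = - 16 * dxw - 32 * cxz - 32 * cxw - 45 * czw + 45 * dzw"
    using e15 bxw axy cxy by algebra
  have cxz: "8 * cxz = - 8 * cxw - czw + dzw"
    using e23 bxw bzw axz axw dxy dxz by algebra
  have dzw: "43 * dzw = - 43 * dyw + 8 * cxw + 8 * dxw"
    using e27 bxy cyz dyz byz axz axy cxy dxy dxz by algebra
  have bxz: "10320 * bxz = - 1288 * cxw - 1288 * dxw - 10535 * czw - 2279 * dyw"
    using e20 bxw azw byz bzw axw dxz cxz dzw by algebra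
  have cxw: "8 * cxw = - 8 * dxw + 43 * czw + 43 * dyw"
    using e21 bxw azw byz bzw axz dxy dxz cxz dzw bxz by algebra
  have czw: "11 * czw = - 59 * dyw"
    using e25 bxy cyz byz ayz axz cxy dxy dxz cxz dzw bxz cxw by algebra
  have dyw: "dyw = 0"
    using e26 bxy cyz dyz byz ayz axy cxy dxy dxz cxz dzw bxz cxw czw by algebra
  \<comment> \<open>Back substitution in the reverse order of the elimination expresses everything
    through \<open>dxw\<close>.\<close>
  have dyw': "dyw = 0"
    by fact
  have czw': "czw = 0"
    using czw dyw' by algebra
  have cxw': "cxw = -dxw"
    using cxw czw' dyw' by algebra
  have bxz': "bxz = 0"
    using bxz cxw' czw' dyw' by algebra
  have dzw': "dzw = 0"
    using dzw dyw' cxw' by algebra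
  have cxz': "cxz = dxw"
    using cxz cxw' czw' dzw' by algebra
  have dxz': "dxz = -dxw"
    using dxz cxz' cxw' czw' dzw' by algebra
  have dxy': "dxy = dxw"
    using dxy cxw' dxz' dyw' dzw' by algebra
  have cxy': "cxy = -dxw"
    using cxy cxz' cxw' dxy' dxz' by algebra
  have axw': "axw = 0"
    using axw cxw' dyw' dzw' by algebra
  have axy': "axy = 0"
    using axy cxy' dxy' czw' dzw' by algebra
  have axz': "axz = 0"
    using axz dxy' cxz' dxz' cxw' by algebra
  have ayz': "ayz = 0"
    using ayz dyw' dzw' czw' by algebra
  have bzw': "bzw = 0"
    using bzw czw' dzw' by algebra
  have byz': "byz = 0"
    using byz dyw' dzw' by algebra
  have dyz': "dyz = 0"
    using dyz dyw' czw' dzw' by algebra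
  have byw': "byw = 0"
    using byw ayz' czw' dyz' by algebra
  have azw': "azw = 0"
    using azw byz' dyw' dzw' by algebra
  have ayw': "ayw = 0"
    using ayw byz' dyw' dzw' by algebra
  have cyz': "cyz = 0"
    using cyz dyz' czw' dzw' by algebra
  have cyw': "cyw = 0"
    using cyw dyw' czw' dzw' by algebra
  have bxy': "bxy = 0"
    using bxy dxy' bxz' dxz' by algebra
  have bxw': "bxw = 0"
    using bxw bxz' cxz' cxw' by algebra
  show "axy = 0" "bxy = 0" "cxy = -dxw" "dxy = dxw" "axz = 0" "bxz = 0" "cxz = dxw" "dxz = -dxw" "axw = 0" "bxw = 0" "cxw = -dxw" "ayz = 0" "byz = 0" "cyz = 0" "dyz = 0" "ayw = 0" "byw = 0" "cyw = 0" "dyw = 0" "azw = 0" "bzw = 0" "czw = 0" "dzw = 0"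
    by fact+
qed

text \<open>The surviving sextic is a multiple of x (y - z) (y - w) (z - w) (x^2 - yz - yw - zw).
  All four planes pass through [0:1:1:1] and the quadric does not; each of the other two points lies
  on the quadric and on exactly one of the planes. This is why the multiplicities are exactly 4, 2,
  2.\<close>

lemma sextic_at_test_points:
  fixes F :: "4 cpoly"
  assumes F: "homogeneous 6 F" and Z: "\<And>z. z \<in> Z60 \<Longrightarrow> eval_poly F (($) (rep_P3 z)) = 0"
    and vP: "vanish_order 4 F (($) (vector [0, 1, 1, 1]))"
    and vQ: "vanish_order 2 F (($) (vector [1, 0, 1, 1]))"
    and vR: "vanish_order 2 F (($) (vector [1, - 1, - 1, 0]))"
    and nonzero: "F \<noteq> 0"
  shows "eval_poly (deriv_list [1, 2, 4, 4] F) (($) (vector [0, 1, 1, 1])) \<noteq> 0"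
    "eval_poly (deriv_list [2, 3] F) (($) (vector [1, 0, 1, 1])) \<noteq> 0"
    "eval_poly (deriv_list [3, 4] F) (($) (vector [1, - 1, - 1, 0])) \<noteq> 0"
proof -
  note vP = vP[unfolded vanish_order_def, rule_format]
  note vQ = vQ[unfolded vanish_order_def, rule_format]
  note vR = vR[unfolded vanish_order_def, rule_format]
  note Z = sextic_through_Z60[OF F Z, simplified]
  note ev = eval_homogeneous[OF homogeneous_deriv_list[OF F]]
  note evs = sum_simps lookup_partial_deriv_expo Z
  \<comment> \<open>By Euler's relation the derivatives of top order carry all the information: 20
    of order 3 at the quadruple point and 4 of order 1 at each double point.\<close>
  have d0: "eval_poly (deriv_list [4, 4, 4] F) (($) (vector [0, 1, 1, 1])) =
      - 24 * cf F 4 1 1 0 - 60 * cf F 0 5 0 1 - 6 * cf F 2 3 0 1 - 60 * cf F 0 0 5 1 - 6 * cf F 2 0 3 1"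
    unfolding ev by (simp add: evs)
  have e0: "- 24 * cf F 4 1 1 0 - 60 * cf F 0 5 0 1 - 6 * cf F 2 3 0 1 - 60 * cf F 0 0 5 1 - 6 * cf F 2 0 3 1 = 0"
    by (rule trans[OF d0[symmetric] vP]) simp
  have d1: "eval_poly (deriv_list [3, 4, 4] F) (($) (vector [0, 1, 1, 1])) =
      - 12 * cf F 4 1 1 0 - 6 * cf F 2 3 1 0 + 2 * cf F 0 3 1 2 - 12 * cf F 2 3 0 1 - 20 * cf F 0 0 5 1 - 6 * cf F 2 0 3 1"
    unfolding ev by (simp add: evs)
  have e1: "- 12 * cf F 4 1 1 0 - 6 * cf F 2 3 1 0 + 2 * cf F 0 3 1 2 - 12 * cf F 2 3 0 1 - 20 * cf F 0 0 5 1 - 6 * cf F 2 0 3 1 = 0"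
    by (rule trans[OF d1[symmetric] vP]) simp
  have d2: "eval_poly (deriv_list [3, 3, 4] F) (($) (vector [0, 1, 1, 1])) =
      - 12 * cf F 2 3 1 0 - 12 * cf F 4 1 0 1 - 6 * cf F 2 3 0 1 + 2 * cf F 0 3 2 1 + 20 * cf F 0 0 5 1 + 6 * cf F 0 2 3 1"
    unfolding ev by (simp add: evs)
  have e2: "- 12 * cf F 2 3 1 0 - 12 * cf F 4 1 0 1 - 6 * cf F 2 3 0 1 + 2 * cf F 0 3 2 1 + 20 * cf F 0 0 5 1 + 6 * cf F 0 2 3 1 = 0"
    by (rule trans[OF d2[symmetric] vP]) simp
  have d3: "eval_poly (deriv_list [3, 3, 3] F) (($) (vector [0, 1, 1, 1])) =
      - 60 * cf F 0 5 1 0 - 6 * cf F 2 3 1 0 - 24 * cf F 4 1 0 1 + 60 * cf F 0 0 5 1 + 6 * cf F 0 2 3 1"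
    unfolding ev by (simp add: evs)
  have e3: "- 60 * cf F 0 5 1 0 - 6 * cf F 2 3 1 0 - 24 * cf F 4 1 0 1 + 60 * cf F 0 0 5 1 + 6 * cf F 0 2 3 1 = 0"
    by (rule trans[OF d3[symmetric] vP]) simp
  have d4: "eval_poly (deriv_list [2, 4, 4] F) (($) (vector [0, 1, 1, 1])) =
      - 12 * cf F 4 1 1 0 - 2 * cf F 2 3 1 0 + 6 * cf F 0 3 1 2 - 20 * cf F 0 5 0 1 - 6 * cf F 2 3 0 1 - 12 * cf F 2 0 3 1"
    unfolding ev by (simp add: evs)
  have e4: "- 12 * cf F 4 1 1 0 - 2 * cf F 2 3 1 0 + 6 * cf F 0 3 1 2 - 20 * cf F 0 5 0 1 - 6 * cf F 2 3 0 1 - 12 * cf F 2 0 3 1 = 0"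
    by (rule trans[OF d4[symmetric] vP]) simp
  have d5: "eval_poly (deriv_list [2, 3, 4] F) (($) (vector [0, 1, 1, 1])) =
      - 4 * cf F 4 1 1 0 - 6 * cf F 2 3 1 0 + 6 * cf F 0 3 1 2 - 4 * cf F 4 1 0 1 - 6 * cf F 2 3 0 1 + 6 * cf F 0 3 2 1 - 4 * cf F 4 0 1 1 - 6 * cf F 2 0 3 1 + 6 * cf F 0 2 3 1"
    unfolding ev by (simp add: evs)
  have e5: "- 4 * cf F 4 1 1 0 - 6 * cf F 2 3 1 0 + 6 * cf F 0 3 1 2 - 4 * cf F 4 1 0 1 - 6 * cf F 2 3 0 1 + 6 * cf F 0 3 2 1 - 4 * cf F 4 0 1 1 - 6 * cf F 2 0 3 1 + 6 * cf F 0 2 3 1 = 0"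
    by (rule trans[OF d5[symmetric] vP]) simp
  have d6: "eval_poly (deriv_list [2, 3, 3] F) (($) (vector [0, 1, 1, 1])) =
      - 20 * cf F 0 5 1 0 - 6 * cf F 2 3 1 0 - 12 * cf F 4 1 0 1 - 2 * cf F 2 3 0 1 + 6 * cf F 0 3 2 1 + 12 * cf F 0 2 3 1"
    unfolding ev by (simp add: evs)
  have e6: "- 20 * cf F 0 5 1 0 - 6 * cf F 2 3 1 0 - 12 * cf F 4 1 0 1 - 2 * cf F 2 3 0 1 + 6 * cf F 0 3 2 1 + 12 * cf F 0 2 3 1 = 0"
    by (rule trans[OF d6[symmetric] vP]) simp
  have d7: "eval_poly (deriv_list [2, 2, 4] F) (($) (vector [0, 1, 1, 1])) =
      12 * cf F 0 3 1 2 + 20 * cf F 0 5 0 1 + 6 * cf F 0 3 2 1 - 12 * cf F 4 0 1 1 - 6 * cf F 2 0 3 1 + 2 * cf F 0 2 3 1"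
    unfolding ev by (simp add: evs)
  have e7: "12 * cf F 0 3 1 2 + 20 * cf F 0 5 0 1 + 6 * cf F 0 3 2 1 - 12 * cf F 4 0 1 1 - 6 * cf F 2 0 3 1 + 2 * cf F 0 2 3 1 = 0"
    by (rule trans[OF d7[symmetric] vP]) simp
  have d8: "eval_poly (deriv_list [2, 2, 3] F) (($) (vector [0, 1, 1, 1])) =
      20 * cf F 0 5 1 0 + 6 * cf F 0 3 1 2 + 12 * cf F 0 3 2 1 - 12 * cf F 4 0 1 1 - 2 * cf F 2 0 3 1 + 6 * cf F 0 2 3 1"
    unfolding ev by (simp add: evs)
  have e8: "20 * cf F 0 5 1 0 + 6 * cf F 0 3 1 2 + 12 * cf F 0 3 2 1 - 12 * cf F 4 0 1 1 - 2 * cf F 2 0 3 1 + 6 * cf F 0 2 3 1 = 0"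
    by (rule trans[OF d8[symmetric] vP]) simp
  have d9: "eval_poly (deriv_list [2, 2, 2] F) (($) (vector [0, 1, 1, 1])) =
      60 * cf F 0 5 1 0 + 6 * cf F 0 3 1 2 + 60 * cf F 0 5 0 1 + 6 * cf F 0 3 2 1 - 24 * cf F 4 0 1 1"
    unfolding ev by (simp add: evs)
  have e9: "60 * cf F 0 5 1 0 + 6 * cf F 0 3 1 2 + 60 * cf F 0 5 0 1 + 6 * cf F 0 3 2 1 - 24 * cf F 4 0 1 1 = 0"
    by (rule trans[OF d9[symmetric] vP]) simp
  have d10: "eval_poly (deriv_list [1, 4, 4] F) (($) (vector [0, 1, 1, 1])) =
      - 12 * cf F 1 1 4 0 - 2 * cf F 3 1 2 0 - 12 * cf F 1 4 1 0 - 2 * cf F 3 2 1 0 - 20 * cf F 5 0 0 1 - 6 * cf F 3 2 0 1 - 6 * cf F 3 0 2 1"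
    unfolding ev by (simp add: evs)
  have e10: "- 12 * cf F 1 1 4 0 - 2 * cf F 3 1 2 0 - 12 * cf F 1 4 1 0 - 2 * cf F 3 2 1 0 - 20 * cf F 5 0 0 1 - 6 * cf F 3 2 0 1 - 6 * cf F 3 0 2 1 = 0"
    by (rule trans[OF d10[symmetric] vP]) simp
  have d11: "eval_poly (deriv_list [1, 3, 4] F) (($) (vector [0, 1, 1, 1])) =
      - 4 * cf F 1 4 1 0 - 6 * cf F 3 2 1 0 - 4 * cf F 1 4 0 1 - 6 * cf F 3 2 0 1"
    unfolding ev by (simp add: evs)
  have e11: "- 4 * cf F 1 4 1 0 - 6 * cf F 3 2 1 0 - 4 * cf F 1 4 0 1 - 6 * cf F 3 2 0 1 = 0"
    by (rule trans[OF d11[symmetric] vP]) simp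
  have d12: "eval_poly (deriv_list [1, 3, 3] F) (($) (vector [0, 1, 1, 1])) =
      12 * cf F 1 1 4 0 - 2 * cf F 3 1 0 2 - 20 * cf F 5 0 1 0 - 6 * cf F 3 2 1 0 - 6 * cf F 3 0 1 2 - 12 * cf F 1 4 0 1 - 2 * cf F 3 2 0 1"
    unfolding ev by (simp add: evs)
  have e12: "12 * cf F 1 1 4 0 - 2 * cf F 3 1 0 2 - 20 * cf F 5 0 1 0 - 6 * cf F 3 2 1 0 - 6 * cf F 3 0 1 2 - 12 * cf F 1 4 0 1 - 2 * cf F 3 2 0 1 = 0"
    by (rule trans[OF d12[symmetric] vP]) simp
  have d13: "eval_poly (deriv_list [1, 2, 4] F) (($) (vector [0, 1, 1, 1])) =
      - 4 * cf F 1 1 4 0 - 6 * cf F 3 1 2 0 + 4 * cf F 1 4 0 1 - 6 * cf F 3 0 2 1"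
    unfolding ev by (simp add: evs)
  have e13: "- 4 * cf F 1 1 4 0 - 6 * cf F 3 1 2 0 + 4 * cf F 1 4 0 1 - 6 * cf F 3 0 2 1 = 0"
    by (rule trans[OF d13[symmetric] vP]) simp
  have d14: "eval_poly (deriv_list [1, 2, 3] F) (($) (vector [0, 1, 1, 1])) =
      4 * cf F 1 1 4 0 - 6 * cf F 3 1 0 2 + 4 * cf F 1 4 1 0 - 6 * cf F 3 0 1 2"
    unfolding ev by (simp add: evs)
  have e14: "4 * cf F 1 1 4 0 - 6 * cf F 3 1 0 2 + 4 * cf F 1 4 1 0 - 6 * cf F 3 0 1 2 = 0"
    by (rule trans[OF d14[symmetric] vP]) simp
  have d15: "eval_poly (deriv_list [1, 2, 2] F) (($) (vector [0, 1, 1, 1])) =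
      - 20 * cf F 5 1 0 0 - 6 * cf F 3 1 2 0 - 6 * cf F 3 1 0 2 + 12 * cf F 1 4 1 0 - 2 * cf F 3 0 1 2 + 12 * cf F 1 4 0 1 - 2 * cf F 3 0 2 1"
    unfolding ev by (simp add: evs)
  have e15: "- 20 * cf F 5 1 0 0 - 6 * cf F 3 1 2 0 - 6 * cf F 3 1 0 2 + 12 * cf F 1 4 1 0 - 2 * cf F 3 0 1 2 + 12 * cf F 1 4 0 1 - 2 * cf F 3 0 2 1 = 0"
    by (rule trans[OF d15[symmetric] vP]) simp
  have d16: "eval_poly (deriv_list [1, 1, 4] F) (($) (vector [0, 1, 1, 1])) =
      2 * cf F 2 3 0 1 - 6 * cf F 0 3 2 1 + 2 * cf F 2 0 3 1 - 6 * cf F 0 2 3 1"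
    unfolding ev by (simp add: evs)
  have e16: "2 * cf F 2 3 0 1 - 6 * cf F 0 3 2 1 + 2 * cf F 2 0 3 1 - 6 * cf F 0 2 3 1 = 0"
    by (rule trans[OF d16[symmetric] vP]) simp
  have d17: "eval_poly (deriv_list [1, 1, 3] F) (($) (vector [0, 1, 1, 1])) =
      2 * cf F 2 3 1 0 - 6 * cf F 0 3 1 2 + 6 * cf F 2 0 3 1 - 2 * cf F 0 2 3 1"
    unfolding ev by (simp add: evs)
  have e17: "2 * cf F 2 3 1 0 - 6 * cf F 0 3 1 2 + 6 * cf F 2 0 3 1 - 2 * cf F 0 2 3 1 = 0"
    by (rule trans[OF d17[symmetric] vP]) simp
  have d18: "eval_poly (deriv_list [1, 1, 2] F) (($) (vector [0, 1, 1, 1])) =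
      6 * cf F 2 3 1 0 - 2 * cf F 0 3 1 2 + 6 * cf F 2 3 0 1 - 2 * cf F 0 3 2 1"
    unfolding ev by (simp add: evs)
  have e18: "6 * cf F 2 3 1 0 - 2 * cf F 0 3 1 2 + 6 * cf F 2 3 0 1 - 2 * cf F 0 3 2 1 = 0"
    by (rule trans[OF d18[symmetric] vP]) simp
  have d19: "eval_poly (deriv_list [1, 1, 1] F) (($) (vector [0, 1, 1, 1])) =
      6 * cf F 3 1 2 0 + 6 * cf F 3 1 0 2 + 6 * cf F 3 2 1 0 + 6 * cf F 3 0 1 2 + 6 * cf F 3 2 0 1 + 6 * cf F 3 0 2 1"
    unfolding ev by (simp add: evs)
  have e19: "6 * cf F 3 1 2 0 + 6 * cf F 3 1 0 2 + 6 * cf F 3 2 1 0 + 6 * cf F 3 0 1 2 + 6 * cf F 3 2 0 1 + 6 * cf F 3 0 2 1 = 0"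
    by (rule trans[OF d19[symmetric] vP]) simp
  have d20: "eval_poly (deriv_list [4] F) (($) (vector [1, 0, 1, 1])) =
      - 4 * cf F 1 4 1 0 - 2 * cf F 3 2 1 0 + 2 * cf F 3 0 1 2 - 4 * cf F 5 0 0 1 - cf F 1 4 0 1 - 3 * cf F 3 2 0 1 + cf F 3 0 2 1 - 4 * cf F 0 0 5 1 + cf F 4 0 1 1 + cf F 2 0 3 1 - 3 * cf F 0 2 3 1"
    unfolding ev by (simp add: evs)
  have e20: "- 4 * cf F 1 4 1 0 - 2 * cf F 3 2 1 0 + 2 * cf F 3 0 1 2 - 4 * cf F 5 0 0 1 - cf F 1 4 0 1 - 3 * cf F 3 2 0 1 + cf F 3 0 2 1 - 4 * cf F 0 0 5 1 + cf F 4 0 1 1 + cf F 2 0 3 1 - 3 * cf F 0 2 3 1 = 0"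
    by (rule trans[OF d20[symmetric] vQ]) simp
  have d21: "eval_poly (deriv_list [3] F) (($) (vector [1, 0, 1, 1])) =
      - 4 * cf F 5 0 1 0 - cf F 1 4 1 0 - 3 * cf F 3 2 1 0 + cf F 3 0 1 2 - 4 * cf F 1 4 0 1 - 2 * cf F 3 2 0 1 + 2 * cf F 3 0 2 1 + 4 * cf F 0 0 5 1 + cf F 4 0 1 1 + 3 * cf F 2 0 3 1 - cf F 0 2 3 1"
    unfolding ev by (simp add: evs)
  have e21: "- 4 * cf F 5 0 1 0 - cf F 1 4 1 0 - 3 * cf F 3 2 1 0 + cf F 3 0 1 2 - 4 * cf F 1 4 0 1 - 2 * cf F 3 2 0 1 + 2 * cf F 3 0 2 1 + 4 * cf F 0 0 5 1 + cf F 4 0 1 1 + 3 * cf F 2 0 3 1 - cf F 0 2 3 1 = 0"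
    by (rule trans[OF d21[symmetric] vQ]) simp
  have d22: "eval_poly (deriv_list [2] F) (($) (vector [1, 0, 1, 1])) =
      cf F 5 1 0 0 + cf F 3 1 2 0 + cf F 3 1 0 2 - cf F 0 5 1 0 - cf F 2 3 1 0 - cf F 0 3 1 2 - cf F 0 5 0 1 - cf F 2 3 0 1 - cf F 0 3 2 1"
    unfolding ev by (simp add: evs)
  have e22: "cf F 5 1 0 0 + cf F 3 1 2 0 + cf F 3 1 0 2 - cf F 0 5 1 0 - cf F 2 3 1 0 - cf F 0 3 1 2 - cf F 0 5 0 1 - cf F 2 3 0 1 - cf F 0 3 2 1 = 0"
    by (rule trans[OF d22[symmetric] vQ]) simp
  have d23: "eval_poly (deriv_list [1] F) (($) (vector [1, 0, 1, 1])) =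
      4 * cf F 5 0 1 0 - cf F 1 4 1 0 - cf F 3 2 1 0 + 3 * cf F 3 0 1 2 + 4 * cf F 5 0 0 1 - cf F 1 4 0 1 - cf F 3 2 0 1 + 3 * cf F 3 0 2 1 + 4 * cf F 4 0 1 1 + 2 * cf F 2 0 3 1 - 2 * cf F 0 2 3 1"
    unfolding ev by (simp add: evs)
  have e23: "4 * cf F 5 0 1 0 - cf F 1 4 1 0 - cf F 3 2 1 0 + 3 * cf F 3 0 1 2 + 4 * cf F 5 0 0 1 - cf F 1 4 0 1 - cf F 3 2 0 1 + 3 * cf F 3 0 2 1 + 4 * cf F 4 0 1 1 + 2 * cf F 2 0 3 1 - 2 * cf F 0 2 3 1 = 0"
    by (rule trans[OF d23[symmetric] vQ]) simp
  have d24: "eval_poly (deriv_list [4] F) (($) (vector [1, - 1, - 1, 0])) =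
      cf F 5 0 0 1 + cf F 3 2 0 1 + cf F 3 0 2 1 - cf F 0 5 0 1 - cf F 2 3 0 1 - cf F 0 3 2 1 - cf F 0 0 5 1 - cf F 2 0 3 1 - cf F 0 2 3 1"
    unfolding ev by (simp add: evs)
  have e24: "cf F 5 0 0 1 + cf F 3 2 0 1 + cf F 3 0 2 1 - cf F 0 5 0 1 - cf F 2 3 0 1 - cf F 0 3 2 1 - cf F 0 0 5 1 - cf F 2 0 3 1 - cf F 0 2 3 1 = 0"
    by (rule trans[OF d24[symmetric] vR]) simp
  have d25: "eval_poly (deriv_list [3] F) (($) (vector [1, - 1, - 1, 0])) =
      4 * cf F 1 1 4 0 + 2 * cf F 3 1 2 0 - 2 * cf F 3 1 0 2 - 4 * cf F 5 0 1 0 + cf F 1 4 1 0 + cf F 3 2 1 0 - 3 * cf F 3 0 1 2 + 4 * cf F 0 5 1 0 - cf F 4 1 1 0 - cf F 2 3 1 0 + 3 * cf F 0 3 1 2"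
    unfolding ev by (simp add: evs)
  have e25: "4 * cf F 1 1 4 0 + 2 * cf F 3 1 2 0 - 2 * cf F 3 1 0 2 - 4 * cf F 5 0 1 0 + cf F 1 4 1 0 + cf F 3 2 1 0 - 3 * cf F 3 0 1 2 + 4 * cf F 0 5 1 0 - cf F 4 1 1 0 - cf F 2 3 1 0 + 3 * cf F 0 3 1 2 = 0"
    by (rule trans[OF d25[symmetric] vR]) simp
  have d26: "eval_poly (deriv_list [2] F) (($) (vector [1, - 1, - 1, 0])) =
      - 4 * cf F 5 1 0 0 + cf F 1 1 4 0 + cf F 3 1 2 0 - 3 * cf F 3 1 0 2 + 4 * cf F 1 4 1 0 + 2 * cf F 3 2 1 0 - 2 * cf F 3 0 1 2 - 4 * cf F 0 5 1 0 - cf F 4 1 1 0 - 3 * cf F 2 3 1 0 + cf F 0 3 1 2"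
    unfolding ev by (simp add: evs)
  have e26: "- 4 * cf F 5 1 0 0 + cf F 1 1 4 0 + cf F 3 1 2 0 - 3 * cf F 3 1 0 2 + 4 * cf F 1 4 1 0 + 2 * cf F 3 2 1 0 - 2 * cf F 3 0 1 2 - 4 * cf F 0 5 1 0 - cf F 4 1 1 0 - 3 * cf F 2 3 1 0 + cf F 0 3 1 2 = 0"
    by (rule trans[OF d26[symmetric] vR]) simp
  have d27: "eval_poly (deriv_list [1] F) (($) (vector [1, - 1, - 1, 0])) =
      - 4 * cf F 5 1 0 0 - cf F 1 1 4 0 - 3 * cf F 3 1 2 0 + cf F 3 1 0 2 - 4 * cf F 5 0 1 0 - cf F 1 4 1 0 - 3 * cf F 3 2 1 0 + cf F 3 0 1 2 + 4 * cf F 4 1 1 0 + 2 * cf F 2 3 1 0 - 2 * cf F 0 3 1 2"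
    unfolding ev by (simp add: evs)
  have e27: "- 4 * cf F 5 1 0 0 - cf F 1 1 4 0 - 3 * cf F 3 1 2 0 + cf F 3 1 0 2 - 4 * cf F 5 0 1 0 - cf F 1 4 1 0 - 3 * cf F 3 2 1 0 + cf F 3 0 1 2 + 4 * cf F 4 1 1 0 + 2 * cf F 2 3 1 0 - 2 * cf F 0 3 1 2 = 0"
    by (rule trans[OF d27[symmetric] vR]) simp
  note K = test_point_linear_system[OF e0 e1 e2 e3 e4 e5 e6 e7 e8 e9 e10 e11 e12 e13 e14 e15 e16 e17 e18 e19 e20 e21 e22 e23 e24 e25 e26 e27, simplified]
  have t: "cf F 3 0 2 1 \<noteq> 0"
  proof
    assume t: "cf F 3 0 2 1 = 0"
    have "F = 0"
      by (rule homogeneous_eq_zero[OF F])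
        (simp add: atMost_nat_numeral atMost_Suc Suc_Suc_0 Z K t[simplified])
    with nonzero show False ..
  qed
  \<comment> \<open>Each list names a monomial occurring in the leading form at its point: x y w^2
    in x (y - z) (y - w) (z - w), then yz and zw in the product of a plane with the tangent plane of
    the quadric.\<close>
  show "eval_poly (deriv_list [1, 2, 4, 4] F) (($) (vector [0, 1, 1, 1])) \<noteq> 0"
    unfolding ev using t by (simp add: evs K)
  show "eval_poly (deriv_list [2, 3] F) (($) (vector [1, 0, 1, 1])) \<noteq> 0"
    unfolding ev using t by (simp add: evs K)
  show "eval_poly (deriv_list [3, 4] F) (($) (vector [1, - 1, - 1, 0])) \<noteq> 0"
    unfolding ev using t by (simp add: evs K)
qed

subsection \<open>The sextics with a quadruple point\<close>

text \<open>The entry \<open>(i, j, k, l, s, e)\<close> is the form \<open>p\<^bsub>ij\<^esub> + s p\<^bsub>kl\<^esub>\<close>, occurring with sign \<open>e\<close>.\<close>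

definition klein_list :: "(4 \<times> 4 \<times> 4 \<times> 4 \<times> complex \<times> complex) list" where
  "klein_list = [(1, 2, 3, 4, 1, 1), (1, 2, 3, 4, - 1, - 1), (1, 3, 2, 4, 1, - 1),
    (1, 3, 2, 4, - 1, 1), (1, 4, 2, 3, 1, 1), (1, 4, 2, 3, - 1, - 1)]"

definition klein_form :: "4 \<Rightarrow> 4 \<Rightarrow> 4 \<Rightarrow> 4 \<Rightarrow> complex \<Rightarrow> (4 \<Rightarrow> complex) \<Rightarrow> (4 \<Rightarrow> complex) \<Rightarrow> complex" where
  "klein_form i j k l s a x = a i * x j - a j * x i + s * (a k * x l - a l * x k)"

definition klein_poly :: "4 \<Rightarrow> 4 \<Rightarrow> 4 \<Rightarrow> 4 \<Rightarrow> complex \<Rightarrow> (4 \<Rightarrow> complex) \<Rightarrow> 4 cpoly" where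
  "klein_poly i j k l s a = sg (sg j 1) (a i) + sg (sg i 1) (- a j) +
     sg (sg l 1) (s * a k) + sg (sg k 1) (- s * a l)"

lemma eval_klein_poly [simp]: "eval_poly (klein_poly i j k l s a) x = klein_form i j k l s a x"
  by (simp add: klein_poly_def klein_form_def mon_eval_single algebra_simps)

lemma klein_form_self [simp]: "klein_form i j k l s a a = 0"
  by (simp add: klein_form_def)

lemma klein_form_scale: "klein_form i j k l s (\<lambda>v. c * a v) x = c * klein_form i j k l s a x"
  by (simp add: klein_form_def algebra_simps)

lemma homogeneous_klein_poly: "homogeneous 1 (klein_poly i j k l s a)"
proof -
  have "homogeneous 1 (sg (sg v 1) c)" for v :: 4 and c
    using homogeneous_single[of "sg v 1" c] by simp
  then show ?thesis unfolding klein_poly_def by (intro homogeneous_add)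
qed

definition klein_sextic :: "(4 \<Rightarrow> complex) \<Rightarrow> (4 \<Rightarrow> complex) \<Rightarrow> (4 \<Rightarrow> complex) \<Rightarrow> 4 cpoly" where
  "klein_sextic p a b = (\<Sum>(i, j, k, l, s, e)\<leftarrow>klein_list.
     const_poly e * (klein_poly i j k l s a * klein_poly i j k l s b) * klein_poly i j k l s p ^ 4)"

lemma homogeneous_klein_sextic: "homogeneous 6 (klein_sextic p a b)"
proof -
  have "homogeneous 6 (const_poly e * (klein_poly i j k l s a * klein_poly i j k l s b) * klein_poly i j k l s p ^ 4)"
    for i j k l s e
    using homogeneous_mult[OF homogeneous_mult[OF homogeneous_const
        homogeneous_mult[OF homogeneous_klein_poly homogeneous_klein_poly]] homogeneous_power[OF homogeneous_klein_poly, of 4]]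
    by simp
  then show ?thesis
    unfolding klein_sextic_def klein_list_def by (auto intro!: homogeneous_add)
qed

text \<open>The forms are alternating in their two points, so every summand contains the fourth
  power of a linear form vanishing at \<open>p\<close>.\<close>

lemma vanish_order_klein_sextic: "vanish_order 4 (klein_sextic p a b) p"
proof -
  have "vanish_order 4 (f * klein_poly i j k l s p ^ 4) p" for f i j k l s
    by (intro vanish_order_mult_right vanish_order_power) simp
  moreover have "vanish_order 4 0 p" by (simp add: vanish_order_def)
  ultimately show ?thesis
    unfolding klein_sextic_def klein_list_def by (auto intro!: vanish_order_add)
qed

lemma eval_klein_sextic:
  "eval_poly (klein_sextic p a b) x = (\<Sum>(i, j, k, l, s, e)\<leftarrow>klein_list.
     e * (klein_form i j k l s a x * klein_form i j k l s b x) * klein_form i j k l s p x ^ 4)"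
  unfolding klein_sextic_def klein_list_def by simp

text \<open>At a point of the configuration the six forms become proportional in pairs, with ratios fourth
  roots of unity, so the six summands cancel in pairs.\<close>

lemma klein_sextic_Z60:
  assumes "z \<in> Z60"
  shows "eval_poly (klein_sextic p a b) (($) (rep_P3 z)) = 0"
proof -
  \<comment> \<open>For fixed second point each form is linear in the first; \<open>L\<close> is its
    value at \<open>u\<close>, and the coefficient vector will be a signed permutation of the
    coordinates of the second point.\<close>
  define L where "L u w1 w2 w3 w4 = u 1 * w1 + u 2 * w2 + u 3 * w3 + u 4 * w4"
    for u :: "4 \<Rightarrow> complex" and w1 w2 w3 w4
  define T where "T w1 w2 w3 w4 = L a w1 w2 w3 w4 * L b w1 w2 w3 w4 * L p w1 w2 w3 w4 ^ 4"
    for w1 w2 w3 w4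
  have L_scale: "L u (c * w1) (c * w2) (c * w3) (c * w4) = c * L u w1 w2 w3 w4" for u c w1 w2 w3 w4
    by (simp add: L_def algebra_simps)
  have T_scale: "T (c * w1) (c * w2) (c * w3) (c * w4) = c ^ 6 * T w1 w2 w3 w4" for c w1 w2 w3 w4
    by (simp add: T_def L_scale power_mult_distrib power4_eq_xxxx eval_nat_numeral mult_ac)
  have i6: "\<i> ^ 6 = - 1" "(- \<i>) ^ 6 = - 1" by (simp_all add: eval_nat_numeral)
  \<comment> \<open>The first nonzero coefficient is normalised to 1. For a fourth root of unity c
    the factor c^6 is 1 or -1, so proportional terms become equal up to sign and \<open>simp\<close>
    can cancel them.\<close>
  have lead: "T (- 1) v w u = T 1 (- v) (- w) (- u)"
      "T \<i> v w u = - T 1 (- \<i> * v) (- \<i> * w) (- \<i> * u)"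
      "T (- \<i>) v w u = - T 1 (\<i> * v) (\<i> * w) (\<i> * u)"
      "T 0 (- 1) w u = T 0 1 (- w) (- u)"
      "T 0 \<i> w u = - T 0 1 (- \<i> * w) (- \<i> * u)"
      "T 0 (- \<i>) w u = - T 0 1 (\<i> * w) (\<i> * u)"
      "T 0 0 (- 1) u = T 0 0 1 (- u)"
      "T 0 0 \<i> u = - T 0 0 1 (- \<i> * u)"
      "T 0 0 (- \<i>) u = - T 0 0 1 (\<i> * u)"
      "T 0 0 0 (- 1) = T 0 0 0 1"
      "T 0 0 0 \<i> = - T 0 0 0 1"
      "T 0 0 0 (- \<i>) = - T 0 0 0 1" for u v w
    using T_scale[of "- 1" 1 "- v" "- w" "- u"] T_scale[of \<i> 1 "- \<i> * v" "- \<i> * w" "- \<i> * u"]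
      T_scale[of "- \<i>" 1 "\<i> * v" "\<i> * w" "\<i> * u"] T_scale[of "- 1" 0 1 "- w" "- u"]
      T_scale[of \<i> 0 1 "- \<i> * w" "- \<i> * u"] T_scale[of "- \<i>" 0 1 "\<i> * w" "\<i> * u"]
      T_scale[of "- 1" 0 0 1 "- u"] T_scale[of \<i> 0 0 1 "- \<i> * u"] T_scale[of "- \<i>" 0 0 1 "\<i> * u"]
      T_scale[of "- 1" 0 0 0 1] T_scale[of \<i> 0 0 0 1] T_scale[of "- \<i>" 0 0 0 1]
    by (simp_all add: i6 flip: mult.assoc)
  have ev: "eval_poly (klein_sextic p a b) (($) (vector [x, y, z, w])) =
      T y (- x) w (- z) - T y (- x) (- w) z - T z w (- x) (- y) + T z (- w) (- x) y +
      T w z (- y) (- x) - T w (- z) y (- x)" for x y z w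
  proof -
    have "klein_form 1 2 3 4 s u (($) (vector [x, y, z, w])) = L u y (- x) (s * w) (- (s * z))"
      "klein_form 1 3 2 4 s u (($) (vector [x, y, z, w])) = L u z (s * w) (- x) (- (s * y))"
      "klein_form 1 4 2 3 s u (($) (vector [x, y, z, w])) = L u w (s * z) (- (s * y)) (- x)" for s u
      by (simp_all add: klein_form_def L_def algebra_simps)
    then show ?thesis by (simp add: eval_klein_sextic klein_list_def T_def)
  qed
  have pt: "eval_poly (klein_sextic p a b) (($) (rep_P3 (pt x y z w))) = 0"
    if "eval_poly (klein_sextic p a b) (($) (vector [x, y, z, w])) = 0" "x = 1 \<or> y = 1 \<or> z = 1 \<or> w = 1" for x y z w
  proof -
    let ?v = "vector [x, y, z, w] :: complex ^ 4"
    have "?v \<noteq> 0" using that(2) by (auto simp: vec_eq_iff forall_4)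
    then obtain c where "c \<noteq> 0" "($) (rep_P3 (pt x y z w)) = (\<lambda>i. c * ?v $ i)"
      unfolding pt_def by (rule rep_P3_abs_P3_scale)
    then show ?thesis
      using that(1) homogeneous_scale[OF homogeneous_klein_sextic, of p a b c "($) ?v"] by simp
  qed
  show ?thesis
    using assms unfolding Z60_def
    by (elim UnE UN_E insertE emptyE) (simp_all add: pt ev lead)
qed

subsection \<open>The open set of general triples\<close>

text \<open>Multiplicities are only bounded below, so that for fixed \<open>x\<close> the solutions
  form a linear space.\<close>

definition passes :: "4 cpoly \<Rightarrow> (4 + 4 + 4 \<Rightarrow> complex) \<Rightarrow> bool" where
  "passes F x \<longleftrightarrow> homogeneous 6 F \<and> (\<forall>z\<in>Z60. eval_poly F (($) (rep_P3 z)) = 0) \<and>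
     vanish_order 4 F (\<lambda>v. x (Inl v)) \<and> vanish_order 2 F (\<lambda>v. x (Inr (Inl v))) \<and>
     vanish_order 2 F (\<lambda>v. x (Inr (Inr v)))"

lemma passes_lincomb:
  assumes "passes F x" "passes G x"
  shows "passes (F + const_poly c * G) x"
proof -
  have "vanish_order k (const_poly c * G) p" if "vanish_order k G p" for k p
    using that by (rule vanish_order_mult_right)
  then show ?thesis
    using assms unfolding passes_def
    by (auto intro!: homogeneous_add homogeneous_const_mult vanish_order_add)
qed

lemma homogeneous_expand:
  fixes F :: "4 cpoly"
  assumes "homogeneous n F"
  shows "F = (\<Sum>m\<in>{m. mdeg m = n}. const_poly (lk F m) * sg m 1)"
proof (rule poly_mapping_eqI)
  fix m
  show "lk F m = lk (\<Sum>m\<in>{m. mdeg m = n}. const_poly (lk F m) * sg m 1) m"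
    using assms
    by (auto simp: lookup_sum lookup_const_poly_mult lookup_single when_def homogeneous_iff finite_mdeg
        if_distrib[of "\<lambda>z. _ * z"] cong: if_cong)
qed

lemma eval_deriv_list_expand:
  fixes c :: "(4 \<Rightarrow>\<^sub>0 nat) \<Rightarrow> complex"
  shows "eval_poly (deriv_list is (\<Sum>m\<in>M. const_poly (c m) * sg m 1)) p =
    (\<Sum>m\<in>M. c m * eval_poly (deriv_list is (sg m 1)) p)"
  by (simp add: deriv_list_sum eval_poly_sum)

text \<open>Each factor is given by the inclusion of its coordinates and the order required there,
  so that the three points share one argument.\<close>

definition slots :: "((4 \<Rightarrow> 4 + 4 + 4) \<times> nat) set" where
  "slots = {(Inl, 4), (\<lambda>v. Inr (Inl v), 2), (\<lambda>v. Inr (Inr v), 2)}"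

lemma passes_slots:
  "passes F x \<longleftrightarrow> homogeneous 6 F \<and> (\<forall>z\<in>Z60. eval_poly F (($) (rep_P3 z)) = 0) \<and>
     (\<forall>(\<iota>, k)\<in>slots. vanish_order k F (\<lambda>v. x (\<iota> v)))"
  by (auto simp: passes_def slots_def)

lemma slot_var: "(\<iota>, k) \<in> slots \<Longrightarrow> \<exists>d. \<forall>v. trihom_fun d (\<lambda>x. x (\<iota> v))"
  unfolding slots_def using trihom_fun_var by blast

text \<open>The unknowns are the coefficients of \<open>F\<close>, and the derivative
  \<open>js\<close> supplies the extra equation. Where the kernel is trivial, this derivative is an
  injective linear functional on the solutions: they form at most a line, and no nonzero one lies in
  its kernel.\<close>

lemma uniqueness_open:
  assumes \<iota>0: "(\<iota>0, k0) \<in> slots"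
    and x0: "\<And>F. passes F x0 \<Longrightarrow> eval_poly (deriv_list js F) (\<lambda>v. x0 (\<iota>0 v)) = 0 \<Longrightarrow> F = 0"
  shows "\<exists>g d. trihom_fun d g \<and> g x0 \<noteq> 0 \<and> (\<forall>x. g x \<noteq> 0 \<longrightarrow>
    (\<forall>F. passes F x \<longrightarrow> eval_poly (deriv_list js F) (\<lambda>v. x (\<iota>0 v)) = 0 \<longrightarrow> F = 0))"
proof -
  define M where "M = {m :: 4 \<Rightarrow>\<^sub>0 nat. mdeg m = 6}"
  have "finite M" unfolding M_def by (rule finite_mdeg)
  \<comment> \<open>Conditions at the configuration do not involve \<open>x\<close>, so these rows
    are constants of degree 0. The empty derivative list lets them share an expansion lemma with
    \<open>row\<close>.\<close>
  define zrow :: "P3 \<Rightarrow> (4 \<Rightarrow>\<^sub>0 nat) \<Rightarrow> (4 + 4 + 4 \<Rightarrow> complex) \<Rightarrow> complex"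
    where "zrow z m x = eval_poly (deriv_list [] (sg m 1)) (($) (rep_P3 z))" for z m x
  define row :: "(4 \<Rightarrow> 4 + 4 + 4) \<Rightarrow> 4 list \<Rightarrow> (4 \<Rightarrow>\<^sub>0 nat) \<Rightarrow> (4 + 4 + 4 \<Rightarrow> complex) \<Rightarrow> complex"
    where "row \<iota> is m x = eval_poly (deriv_list is (sg m 1)) (\<lambda>v. x (\<iota> v))" for \<iota> "is" m x
  define R where "R = zrow ` Z60 \<union> {row \<iota> is | \<iota> k is. (\<iota>, k) \<in> slots \<and> length is < k} \<union> {row \<iota>0 js}"
  define P where "P c = (\<Sum>m\<in>M. const_poly (c m) * sg m 1)" for c :: "(4 \<Rightarrow>\<^sub>0 nat) \<Rightarrow> complex"
  have hom_P: "homogeneous 6 (P c)" for c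
    unfolding P_def M_def
    by (intro homogeneous_sum homogeneous_const_mult) (use homogeneous_single in \<open>metis mem_Collect_eq\<close>)
  have lookup_P: "lk (P c) m = c m" if "m \<in> M" for c m
    using that \<open>finite M\<close> by (simp add: P_def lookup_sum lookup_const_poly_mult lookup_single when_def
        if_distrib[of "\<lambda>z. _ * z"] cong: if_cong)
  have sys: "(\<forall>r\<in>R. (\<Sum>m\<in>M. c m * r m x) = 0) \<longleftrightarrow>
      passes (P c) x \<and> eval_poly (deriv_list js (P c)) (\<lambda>v. x (\<iota>0 v)) = 0" for c x
  proof -
    have 1: "(\<Sum>m\<in>M. c m * row \<iota> is m x) = eval_poly (deriv_list is (P c)) (\<lambda>v. x (\<iota> v))" for \<iota> "is"
      unfolding P_def eval_deriv_list_expand by (simp add: row_def)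
    have 2: "(\<Sum>m\<in>M. c m * zrow z m x) = eval_poly (P c) (($) (rep_P3 z))" for z
      using eval_deriv_list_expand[of "[]" c M] unfolding P_def by (simp add: zrow_def)
    have "(\<forall>r\<in>R. (\<Sum>m\<in>M. c m * r m x) = 0) \<longleftrightarrow>
        (\<forall>z\<in>Z60. (\<Sum>m\<in>M. c m * zrow z m x) = 0) \<and>
        (\<forall>(\<iota>, k)\<in>slots. \<forall>is. length is < k \<longrightarrow> (\<Sum>m\<in>M. c m * row \<iota> is m x) = 0) \<and>
        (\<Sum>m\<in>M. c m * row \<iota>0 js m x) = 0"
      unfolding R_def by blast
    then show ?thesis
      unfolding 1 2 passes_slots vanish_order_def using hom_P by simp
  qed
  have trihom_row: "\<exists>d. \<forall>m\<in>M. trihom_fun d (row \<iota> is m)" if slot: "(\<iota>, k) \<in> slots" for \<iota> k "is"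
  proof -
    obtain d where d: "\<And>v. trihom_fun d (\<lambda>x. x (\<iota> v))" using slot_var[OF slot] by blast
    have "trihom_fun (\<Sum>i<6 - length is. d) (row \<iota> is m)" if "m \<in> M" for m
    proof -
      have "homogeneous 6 (sg m 1)" using that homogeneous_single[of m 1] by (simp add: M_def)
      from trihom_fun_homogeneous[OF homogeneous_deriv_list[OF this, of "is"] d]
      show ?thesis by (simp add: row_def[abs_def])
    qed
    then show ?thesis by blast
  qed
  have "\<exists>g d. trihom_fun d g \<and> g x0 \<noteq> 0 \<and>
    (\<forall>x. g x \<noteq> 0 \<longrightarrow> (\<forall>c. (\<forall>r\<in>R. (\<Sum>m\<in>M. c m * r m x) = 0) \<longrightarrow> (\<forall>m\<in>M. c m = 0)))"
  proof (rule trivial_kernel_open[OF \<open>finite M\<close>])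
    fix r assume "r \<in> R"
    then consider z where "r = zrow z" | \<iota> k "is" where "(\<iota>, k) \<in> slots" "r = row \<iota> is"
      using \<iota>0 unfolding R_def by blast
    then show "\<exists>d. \<forall>m\<in>M. trihom_fun d (r m)"
    proof cases
      case 1
      then show ?thesis using trihom_fun_const by (intro exI[of _ 0]) (simp add: zrow_def[abs_def])
    next
      case 2
      then show ?thesis using trihom_row by simp
    qed
  next
    fix c assume "\<forall>r\<in>R. (\<Sum>m\<in>M. c m * r m x0) = 0"
    then have "P c = 0" unfolding sys using x0 by blast
    then show "\<forall>m\<in>M. c m = 0" using lookup_P by (metis lookup_zero)
  qed
  then obtain g d where g: "trihom_fun d g" "g x0 \<noteq> 0"
    "\<And>x c. g x \<noteq> 0 \<Longrightarrow> \<forall>r\<in>R. (\<Sum>m\<in>M. c m * r m x) = 0 \<Longrightarrow> \<forall>m\<in>M. c m = 0"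
    by blast
  have "F = 0" if x: "g x \<noteq> 0" and F: "passes F x" "eval_poly (deriv_list js F) (\<lambda>v. x (\<iota>0 v)) = 0" for x F
  proof -
    have FP: "F = P (lk F)"
      unfolding P_def M_def using F(1) by (intro homogeneous_expand) (simp add: passes_def)
    then have "\<forall>m\<in>M. lk F m = 0" using g(3)[OF x, of "lk F"] F unfolding sys by simp
    then show ?thesis by (subst FP) (simp add: P_def const_poly_def)
  qed
  with g(1,2) show ?thesis by blast
qed

text \<open>\<open>rep_P3\<close> determines the coordinates of the test points only up to nonzero
  factors, here \<open>c1\<close>, \<open>c2\<close>, \<open>c3\<close>; forms do not notice
  them.\<close>

lemma passes_at_test_points:
  assumes x: "(\<lambda>v. x (Inl v)) = (\<lambda>v. c1 * vector [0, 1, 1, 1] $ v)"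
    "(\<lambda>v. x (Inr (Inl v))) = (\<lambda>v. c2 * vector [1, 0, 1, 1] $ v)"
    "(\<lambda>v. x (Inr (Inr v))) = (\<lambda>v. c3 * vector [1, - 1, - 1, 0] $ v)"
    and c: "c1 \<noteq> 0" "c2 \<noteq> 0" "c3 \<noteq> 0" and F: "passes F x" "F \<noteq> 0"
  shows "eval_poly (deriv_list [1, 2, 4, 4] F) (\<lambda>v. x (Inl v)) \<noteq> 0"
    "eval_poly (deriv_list [2, 3] F) (\<lambda>v. x (Inr (Inl v))) \<noteq> 0"
    "eval_poly (deriv_list [3, 4] F) (\<lambda>v. x (Inr (Inr v))) \<noteq> 0"
proof -
  have hom: "homogeneous 6 F" using F(1) by (simp add: passes_def)
  have v: "vanish_order k F (\<lambda>v. c * p v) \<longleftrightarrow> vanish_order k F p" if "c \<noteq> 0" for k c p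
    unfolding vanish_order_def using deriv_list_scale[OF hom that] by blast
  have "vanish_order 4 F (($) (vector [0, 1, 1, 1]))" "vanish_order 2 F (($) (vector [1, 0, 1, 1]))"
    "vanish_order 2 F (($) (vector [1, - 1, - 1, 0]))"
    using F(1) unfolding passes_def x v[OF c(1)] v[OF c(2)] v[OF c(3)] by blast+
  note nz = sextic_at_test_points[OF hom _ this F(2)]
  show "eval_poly (deriv_list [1, 2, 4, 4] F) (\<lambda>v. x (Inl v)) \<noteq> 0"
    "eval_poly (deriv_list [2, 3] F) (\<lambda>v. x (Inr (Inl v))) \<noteq> 0"
    "eval_poly (deriv_list [3, 4] F) (\<lambda>v. x (Inr (Inr v))) \<noteq> 0"
    unfolding x deriv_list_scale[OF hom c(1)] deriv_list_scale[OF hom c(2)] deriv_list_scale[OF hom c(3)]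
    using nz F(1) unfolding passes_def by blast+
qed

text \<open>The ten sextics with \<open>A\<close>, \<open>B\<close> coordinate points satisfy one linear relation; at the test point it
  involves the pair \<open>(4, 4)\<close>, which is therefore left out.\<close>

definition klein_pairs :: "(4 \<times> 4) set" where
  "klein_pairs = {(1, 1), (1, 2), (1, 3), (1, 4), (2, 2), (2, 3), (2, 4), (3, 3), (3, 4)}"

abbreviation unit_vec :: "4 \<Rightarrow> 4 \<Rightarrow> complex" where
  "unit_vec i \<equiv> \<lambda>v. if v = i then 1 else 0"

definition klein_basis :: "(4 \<Rightarrow> complex) \<Rightarrow> 4 \<times> 4 \<Rightarrow> 4 cpoly" where
  "klein_basis p ij = klein_sextic p (unit_vec (fst ij)) (unit_vec (snd ij))"

lemma klein_basis_independent:
  assumes p: "p = (\<lambda>v. t * vector [0, 1, 1, 1] $ v)" "t \<noteq> 0"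
    and c: "\<And>X. (\<Sum>ij\<in>klein_pairs. c ij * eval_poly (klein_basis p ij) X) = 0"
  shows "\<forall>ij\<in>klein_pairs. c ij = 0"
proof -
  let ?p = "($) (vector [0, 1, 1, 1] :: complex ^ 4)"
  have scale: "eval_poly (klein_sextic p a b) X = t ^ 4 * eval_poly (klein_sextic ?p a b) X" for a b X
    unfolding eval_klein_sextic klein_list_def p(1) klein_form_scale by (simp add: power_mult_distrib algebra_simps)
  have "t ^ 4 * (\<Sum>ij\<in>klein_pairs. c ij * eval_poly (klein_basis ?p ij) X) = 0" for X
    using c[of X] by (simp add: klein_basis_def scale sum_distrib_left mult_ac)
  then have e: "(\<Sum>ij\<in>klein_pairs. c ij * eval_poly (klein_basis ?p ij) (($) (vector [x, y, z, w]))) = 0" for x y z w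
    using p(2) by simp
  note ev = klein_pairs_def klein_basis_def eval_klein_sextic klein_list_def klein_form_def
  \<comment> \<open>The first coordinate of ?p is 0. If that of the probe is 0 too, both forms of a
    pair have equal fourth powers, and their opposite signs leave only mixed products p_ij(A)
    p_kl(B), which vanish unless exactly one of A, B is the first coordinate point. A second zero
    then isolates a single pair.\<close>
  have 1: "c (1, 2) = 0" using e[of 0 0 1 2] by (simp add: ev)
  have 2: "c (1, 3) = 0" using e[of 0 1 0 2] by (simp add: ev)
  have 3: "c (1, 4) = 0" using e[of 0 1 2 0] by (simp add: ev)
  have 4: "c (2, 2) = 0" using e[of 1 0 2 0] by (simp add: ev)
  have 5: "c (3, 3) = 0" using e[of 1 2 0 0] by (simp add: ev)
  have 6: "c (2, 4) = c (2, 3)" using e[of 1 1 2 2] by (simp add: ev 1 2 3 4 5)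
  have 7: "c (3, 4) = c (2, 3)" using e[of 1 2 1 2] by (simp add: ev 1 2 3 4 5)
  have 8: "212 * c (2, 3) = 32 * c (1, 1)" using e[of 1 0 1 "- 1"] by (simp add: ev 1 2 3 4 5 6 7)
  have 9: "c (1, 1) * 16 + 164 * c (2, 3) = 0" using e[of 1 1 2 0] by (simp add: ev 1 2 3 4 5 6 7)
  have "c (2, 3) = 0" "c (1, 1) = 0" using 8 9 by algebra+
  with 1 2 3 4 5 6 7 show ?thesis by (simp add: klein_pairs_def)
qed

text \<open>Independence of the nine sextics, a condition on the first point alone, ensures that a
  nonzero vector solving the gradient equations gives a nonzero polynomial.\<close>

lemma existence_open:
  assumes x0: "(\<lambda>v. x0 (Inl v)) = (\<lambda>v. t * vector [0, 1, 1, 1] $ v)" "t \<noteq> 0"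
  shows "\<exists>g d. trihom_fun d g \<and> g x0 \<noteq> 0 \<and> (\<forall>x. g x \<noteq> 0 \<longrightarrow> (\<exists>F. F \<noteq> 0 \<and> passes F x))"
proof -
  have fin: "finite klein_pairs" by (simp add: klein_pairs_def)
  \<comment> \<open>Independence is tested on values: one equation for every \<open>X\<close>, with
    entries of degree 4 in the first point.\<close>
  define row :: "(4 \<Rightarrow> complex) \<Rightarrow> 4 \<times> 4 \<Rightarrow> (4 + 4 + 4 \<Rightarrow> complex) \<Rightarrow> complex"
    where "row X ij x = eval_poly (klein_basis (\<lambda>v. x (Inl v)) ij) X" for X ij x
  have form: "trihom_fun (1, 0, 0) (\<lambda>x. klein_form i j k l s (\<lambda>v. x (Inl v)) X)" for i j k l s X
    unfolding klein_form_def
    by (intro trihom_fun_add trihom_fun_diff trihom_fun_cmult)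
      (use trihom_fun_cmult[OF trihom_fun_var(1)] in \<open>simp_all add: mult.commute\<close>)
  have trihom_row: "trihom_fun (\<Sum>i<4::nat. (1, 0, 0)) (row X ij)" for X ij
  proof -
    have *: "trihom_fun (\<Sum>i<4::nat. (1, 0, 0)) (\<lambda>x. c * klein_form i j k l s (\<lambda>v. x (Inl v)) X ^ 4)" for c i j k l s
      by (intro trihom_fun_cmult trihom_fun_power form)
    show ?thesis
      unfolding row_def[abs_def] klein_basis_def eval_klein_sextic klein_list_def
      by (simp only: list.map sum_list.Cons sum_list.Nil split_conv)
        (intro trihom_fun_add trihom_fun_zero *)
  qed
  have "\<exists>g d. trihom_fun d g \<and> g x0 \<noteq> 0 \<and>
    (\<forall>x. g x \<noteq> 0 \<longrightarrow> (\<forall>c. (\<forall>r\<in>range row. (\<Sum>ij\<in>klein_pairs. c ij * r ij x) = 0) \<longrightarrow> (\<forall>ij\<in>klein_pairs. c ij = 0)))"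
  proof (rule trivial_kernel_open[OF fin])
    show "\<exists>d. \<forall>ij\<in>klein_pairs. trihom_fun d (r ij)" if "r \<in> range row" for r
      using that trihom_row by blast
    show "\<forall>ij\<in>klein_pairs. c ij = 0" if "\<forall>r\<in>range row. (\<Sum>ij\<in>klein_pairs. c ij * r ij x0) = 0" for c
      using that by (intro klein_basis_independent[OF x0]) (simp add: row_def)
  qed
  then obtain g d where g: "trihom_fun d g" "g x0 \<noteq> 0"
    "\<And>x c. g x \<noteq> 0 \<Longrightarrow> \<forall>r\<in>range row. (\<Sum>ij\<in>klein_pairs. c ij * r ij x) = 0 \<Longrightarrow> \<forall>ij\<in>klein_pairs. c ij = 0"
    by blast
  have "\<exists>F. F \<noteq> 0 \<and> passes F x" if gx: "g x \<noteq> 0" for x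
  proof -
    let ?p = "\<lambda>v. x (Inl v)"
    \<comment> \<open>\<open>True\<close> stands for the second point and \<open>False\<close> for
      the third, so \<open>4 \<times> bool\<close> indexes the eight gradient equations.\<close>
    define q where "q b = (\<lambda>v. x (Inr (if b then Inl v else Inr v)))" for b
    have "card (UNIV :: (4 \<times> bool) set) < card klein_pairs"
      by (simp add: klein_pairs_def card_cartesian_product flip: UNIV_Times_UNIV)
    from underdetermined_system[OF finite_class.finite_UNIV fin this,
        of "\<lambda>(v, b) ij. eval_poly (partial_deriv v (klein_basis ?p ij)) (q b)"]
    obtain c where c: "\<exists>ij\<in>klein_pairs. c ij \<noteq> 0"
      "\<And>v b. (\<Sum>ij\<in>klein_pairs. c ij * eval_poly (partial_deriv v (klein_basis ?p ij)) (q b)) = 0"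
      by auto
    define F where "F = (\<Sum>ij\<in>klein_pairs. const_poly (c ij) * klein_basis ?p ij)"
    have ev: "eval_poly (deriv_list is F) y = (\<Sum>ij\<in>klein_pairs. c ij * eval_poly (deriv_list is (klein_basis ?p ij)) y)"
      for "is" y
      by (simp add: F_def deriv_list_sum eval_poly_sum)
    have hom: "homogeneous 6 F"
      unfolding F_def klein_basis_def
      by (intro homogeneous_sum homogeneous_const_mult homogeneous_klein_sextic)
    have "F \<noteq> 0"
    proof
      assume "F = 0"
      then have "\<forall>r\<in>range row. (\<Sum>ij\<in>klein_pairs. c ij * r ij x) = 0"
        using ev[of "[]"] by (simp add: row_def)
      with g(3)[OF gx] c(1) show False by blast
    qed
    moreover have "eval_poly F (($) (rep_P3 z)) = 0" if "z \<in> Z60" for z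
      using ev[of "[]"] klein_sextic_Z60[OF that] by (simp add: klein_basis_def)
    moreover have "vanish_order 4 F ?p"
      unfolding vanish_order_def ev
      using vanish_order_klein_sextic by (simp add: klein_basis_def vanish_order_def)
    moreover have "vanish_order 2 F (q b)" for b
    proof -
      have d: "eval_poly (partial_deriv v F) (q b) = 0" for v
        using ev[of "[v]"] c(2) by simp
      with euler[OF hom, of "q b"] have "eval_poly F (q b) = 0" by simp
      with d show ?thesis by (simp add: numeral_2_eq_2 vanish_order_Suc)
    qed
    from this[of True] this[of False] have "vanish_order 2 F (\<lambda>v. x (Inr (Inl v)))" "vanish_order 2 F (\<lambda>v. x (Inr (Inr v)))"
      by (simp_all add: q_def)
    ultimately show ?thesis using hom unfolding passes_def by blast
  qed
  with g(1,2) show ?thesis by blast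
qed

section \<open>The open set and the unique surface over each of its triples\<close>

theorem theorem4p4:
  shows "\<exists>U. zariski_open U \<and> U \<noteq> {} \<and>
    (\<forall>P Q\<^sub>1 Q\<^sub>2. (P, Q\<^sub>1, Q\<^sub>2) \<in> U \<longrightarrow>
      (\<exists>!S. surface 6 S \<and> (\<forall>Z\<in>Z60. vanishes_at S Z) \<and>
            has_multiplicity S P 4 \<and> has_multiplicity S Q\<^sub>1 2 \<and> has_multiplicity S Q\<^sub>2 2))"
proof -
  define t0 where "t0 = (pt 0 1 1 1, pt 1 0 1 1, pt 1 (- 1) (- 1) 0)"
  define x0 where "x0 = tri_coords t0"
  have coords: "tri_coords (P, Q, R) (Inl v) = rep_P3 P $ v" "tri_coords (P, Q, R) (Inr (Inl v)) = rep_P3 Q $ v"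
    "tri_coords (P, Q, R) (Inr (Inr v)) = rep_P3 R $ v" for P Q R v
    by (simp_all add: tri_coords_def)
  have nz: "(vector [0, 1, 1, 1] :: complex ^ 4) \<noteq> 0" "(vector [1, 0, 1, 1] :: complex ^ 4) \<noteq> 0"
    "(vector [1, - 1, - 1, 0] :: complex ^ 4) \<noteq> 0"
    by (auto simp: vec_eq_iff forall_4)
  obtain c1 where c1: "c1 \<noteq> 0" "(\<lambda>v. x0 (Inl v)) = (\<lambda>v. c1 * vector [0, 1, 1, 1] $ v)"
    using rep_P3_abs_P3_scale[OF nz(1)] by (auto simp: x0_def t0_def coords pt_def)
  obtain c2 where c2: "c2 \<noteq> 0" "(\<lambda>v. x0 (Inr (Inl v))) = (\<lambda>v. c2 * vector [1, 0, 1, 1] $ v)"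
    using rep_P3_abs_P3_scale[OF nz(2)] by (auto simp: x0_def t0_def coords pt_def)
  obtain c3 where c3: "c3 \<noteq> 0" "(\<lambda>v. x0 (Inr (Inr v))) = (\<lambda>v. c3 * vector [1, - 1, - 1, 0] $ v)"
    using rep_P3_abs_P3_scale[OF nz(3)] by (auto simp: x0_def t0_def coords pt_def)
  note test = passes_at_test_points[OF c1(2) c2(2) c3(2) c1(1) c2(1) c3(1)]
  obtain g0 d0 where g0: "trihom_fun d0 g0" "g0 x0 \<noteq> 0"
    "\<And>x. g0 x \<noteq> 0 \<Longrightarrow> \<exists>F. F \<noteq> 0 \<and> passes F x"
    using existence_open[OF c1(2,1)] by blast
  obtain g1 d1 where g1: "trihom_fun d1 g1" "g1 x0 \<noteq> 0" "\<And>x F. g1 x \<noteq> 0 \<Longrightarrow> passes F x \<Longrightarrow>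
      eval_poly (deriv_list [1, 2, 4, 4] F) (\<lambda>v. x (Inl v)) = 0 \<Longrightarrow> F = 0"
    using uniqueness_open[of Inl 4 x0 "[1, 2, 4, 4]"] test(1) unfolding slots_def by blast
  obtain g2 d2 where g2: "trihom_fun d2 g2" "g2 x0 \<noteq> 0" "\<And>x F. g2 x \<noteq> 0 \<Longrightarrow> passes F x \<Longrightarrow>
      eval_poly (deriv_list [2, 3] F) (\<lambda>v. x (Inr (Inl v))) = 0 \<Longrightarrow> F = 0"
    using uniqueness_open[of "\<lambda>v. Inr (Inl v)" 2 x0 "[2, 3]"] test(2) unfolding slots_def by blast
  obtain g3 d3 where g3: "trihom_fun d3 g3" "g3 x0 \<noteq> 0" "\<And>x F. g3 x \<noteq> 0 \<Longrightarrow> passes F x \<Longrightarrow>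
      eval_poly (deriv_list [3, 4] F) (\<lambda>v. x (Inr (Inr v))) = 0 \<Longrightarrow> F = 0"
    using uniqueness_open[of "\<lambda>v. Inr (Inr v)" 2 x0 "[3, 4]"] test(3) unfolding slots_def by blast
  \<comment> \<open>All four factors are nonzero at the same triple \<open>t0\<close>, which makes
    their common nonvanishing locus nonempty.\<close>
  define g where "g x = g0 x * g1 x * (g2 x * g3 x)" for x
  have "trihom_fun (d0 + d1 + (d2 + d3)) g"
    unfolding g_def[abs_def] by (intro trihom_fun_mult g0(1) g1(1) g2(1) g3(1))
  then obtain f where f: "\<exists>a b c. trihomogeneous a b c f" "g = eval_poly f"
    unfolding trihom_fun_def by blast
  define U where "U = {t. g (tri_coords t) \<noteq> 0}"
  have "zariski_open U"
    unfolding zariski_open_def zariski_closed_def U_def using f by (intro exI[of _ "{f}"]) auto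
  moreover have "t0 \<in> U"
    using g0(2) g1(2) g2(2) g3(2) by (simp add: U_def g_def flip: x0_def)
  moreover have "\<exists>!S. surface 6 S \<and> (\<forall>Z\<in>Z60. vanishes_at S Z) \<and>
      has_multiplicity S P 4 \<and> has_multiplicity S Q 2 \<and> has_multiplicity S R 2"
    if U: "(P, Q, R) \<in> U" for P Q R
  proof -
    define x where "x = tri_coords (P, Q, R)"
    have x: "(\<lambda>v. x (Inl v)) = ($) (rep_P3 P)" "(\<lambda>v. x (Inr (Inl v))) = ($) (rep_P3 Q)"
      "(\<lambda>v. x (Inr (Inr v))) = ($) (rep_P3 R)"
      by (simp_all add: x_def coords)
    have gx: "g0 x \<noteq> 0" "g1 x \<noteq> 0" "g2 x \<noteq> 0" "g3 x \<noteq> 0"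
      using U by (auto simp: U_def g_def x_def)
    obtain F where F: "F \<noteq> 0" "passes F x" using g0(3)[OF gx(1)] by blast
    define eqns where "eqns G = {const_poly c * G | c. c \<noteq> 0}" for G :: "4 cpoly"
    have "order_at F (($) (rep_P3 P)) = 4"
      using order_at_eqI[of 4 F "\<lambda>v. x (Inl v)" "[1, 2, 4, 4]"] g1(3)[OF gx(2) F(2)] F
      unfolding passes_def x by auto
    moreover have "order_at F (($) (rep_P3 Q)) = 2"
      using order_at_eqI[of 2 F "\<lambda>v. x (Inr (Inl v))" "[2, 3]"] g2(3)[OF gx(3) F(2)] F
      unfolding passes_def x by auto
    moreover have "order_at F (($) (rep_P3 R)) = 2"
      using order_at_eqI[of 2 F "\<lambda>v. x (Inr (Inr v))" "[3, 4]"] g3(3)[OF gx(4) F(2)] F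
      unfolding passes_def x by auto
    ultimately have "has_multiplicity (eqns F) P 4" "has_multiplicity (eqns F) Q 2" "has_multiplicity (eqns F) R 2"
      unfolding has_multiplicity_def eqns_def by (auto simp: order_at_const_mult)
    moreover have "surface 6 (eqns F)" "\<forall>Z\<in>Z60. vanishes_at (eqns F) Z"
      using F unfolding surface_def vanishes_at_def eqns_def passes_def by auto
    moreover have "S = eqns F"
      if S: "surface 6 S" "\<forall>Z\<in>Z60. vanishes_at S Z" "has_multiplicity S P 4"
        "has_multiplicity S Q 2" "has_multiplicity S R 2" for S
    proof -
      obtain G where G: "G \<noteq> 0" "homogeneous 6 G" "S = eqns G"
        using S(1) unfolding surface_def eqns_def by blast
      have "const_poly 1 * G = G"
        by (simp add: const_poly_def)
      then have "G \<in> S" unfolding G(3) eqns_def by force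
      then have "passes G x"
        using S(2-5) G(2) vanish_order_order_at[of G]
        unfolding passes_def x vanishes_at_def has_multiplicity_def by metis
      \<comment> \<open>The functional \<open>l\<close> is injective on solutions over
        \<open>U\<close>, so the multiple of \<open>F\<close> on which it agrees with
        \<open>G\<close> must be \<open>G\<close> itself.\<close>
      define l where "l H = eval_poly (deriv_list [1, 2, 4, 4] H) (\<lambda>v. x (Inl v))" for H
      have l: "l F \<noteq> 0" using g1(3)[OF gx(2) F(2)] F(1) unfolding l_def by blast
      define k where "k = l G / l F"
      have "G + const_poly (- k) * F = 0"
      proof (rule g1(3)[OF gx(2)])
        show "passes (G + const_poly (- k) * F) x"
          using \<open>passes G x\<close> F(2) by (rule passes_lincomb)
        have "l (G + const_poly (- k) * F) = l G + - k * l F"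
          unfolding l_def deriv_list_add deriv_list_const_mult by simp
        also have "\<dots> = 0" using l by (simp add: k_def)
        finally show "eval_poly (deriv_list [1, 2, 4, 4] (G + const_poly (- k) * F)) (\<lambda>v. x (Inl v)) = 0"
          by (simp only: l_def)
      qed
      moreover have "const_poly (- k) = - (const_poly k :: 4 cpoly)"
        by (simp add: const_poly_def single_uminus)
      ultimately have Gk: "G = const_poly k * F" by simp
      then have "k \<noteq> 0" using G(1) by (auto simp: const_poly_def)
      \<comment> \<open>Replacing \<open>c\<close> by \<open>c / k\<close> identifies the nonzero
        multiples of \<open>F\<close> with those of \<open>G\<close>, so both define one
        surface.\<close>
      have "(\<exists>c. H = const_poly c * (const_poly k * F) \<and> c \<noteq> 0) \<longleftrightarrow> (\<exists>c. H = const_poly c * F \<and> c \<noteq> 0)" for H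
      proof
        assume "\<exists>c. H = const_poly c * F \<and> c \<noteq> 0"
        then obtain c where "H = const_poly c * F" "c \<noteq> 0" by blast
        then show "\<exists>c. H = const_poly c * (const_poly k * F) \<and> c \<noteq> 0"
          using \<open>k \<noteq> 0\<close> by (intro exI[of _ "c / k"]) (simp add: const_poly_mult)
      next
        assume "\<exists>c. H = const_poly c * (const_poly k * F) \<and> c \<noteq> 0"
        then show "\<exists>c. H = const_poly c * F \<and> c \<noteq> 0"
          using \<open>k \<noteq> 0\<close> unfolding const_poly_mult by (metis mult_eq_0_iff)
      qed
      then show "S = eqns F" unfolding G(3) eqns_def Gk by blast
    qed
    ultimately show ?thesis by blast
  qed
  ultimately show ?thesis by blast
qed

end
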